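(* Let $E$ be a uniformly convex and uniformly smooth real Banach space, $C$ a nonempty closed convex subset of $E$, $T \colon C \to E$ a relatively nonexpansive mapping, $\{\alpha_n \}$ a sequence in $(0,1]$, and $\{\beta_n \}$ a sequence in $[0,1]$. Suppose that $\alpha_n \to 0$, $\sum_{n=1}^\infty \alpha_n = \infty$, and $0 < \liminf_{n\to \infty} \beta_n \leq \limsup_{n\to \infty}\beta_n <1$. Let $u$ be a point in $E$ and $\{x_n\}$ a sequence defined by $x_1 \in C$ and $$x_{n+1} = Q_C J^{-1} \Bigl(\alpha_n J u + (1 - \alpha_n) \bigl( \beta_n J x_n + (1-\beta_n)JT x_n \bigr) \Bigr)$$ for $n\in \mathbb{N}$. Then $\{ x_n \}$ converges strongly to $Q_{F(T)}(u)$.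
   Context: $E^*$ is the dual of $E$, $\langle x, x^*\rangle$ is the value of $x^*\in E^*$ at $x\in E$, and $\mathbb{N}$ is the set of positive integers. The (normalized) duality mapping $J$ of $E$ is $Jx=\{x^*\in E^*: \langle x,x^*\rangle=\|x\|^2=\|x^*\|^2\}$; when $E$ is smooth, strictly convex and reflexive (as is the case here) $J$ is a single-valued bijection of $E$ onto $E^*$, and $J^{-1}$ is its inverse. Define $\phi(x,y)=\|x\|^2-2\langle x,Jy\rangle+\|y\|^2$ for $x,y\in E$. For a nonempty closed convex subset $D$ of $E$ and $x\in E$, $Q_D(x)$ denotes the unique point $x_0\in D$ with $\phi(x_0,x)=\min\{\phi(y,x): y\in D\}$. For a mapping $T\colon C\to E$, $F(T)=\{x\in C: Tx=x\}$. A point $p\in C$ is an asymptotic fixed point of $T$ if there is a sequence $\{x_n\}$ in $C$ converging weakly to $p$ with $x_n-Tx_n\to0$ (strongly); $\hat F(T)$ is the set of asymptotic fixed points of $T$. $T$ is of type (r) if $F(T)\neq\emptyset$ and $\phi(p,Tx)\le\phi(p,x)$ for all $x\in C$ and $p\in F(T)$; in that case $F(T)$ is closed and convex. $T$ is relatively nonexpansive if $T$ is of type (r) and $F(T)=\hat F(T)$. *)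

theory Defs
  imports "HOL-Analysis.Analysis"
begin

text \<open>
  The dual of a real normed space \<open>'a\<close> is the type \<open>'a \<Rightarrow>\<^sub>L real\<close> of bounded linear functionals
  with the operator norm; \<open>blinfun_apply f x\<close> is the value of \<open>f\<close> at \<open>x\<close>.
\<close>

definition uniformly_convex_space :: "'a::real_normed_vector itself \<Rightarrow> bool" where
  "uniformly_convex_space _ \<longleftrightarrow>
     (\<forall>\<epsilon>>0. \<exists>\<delta>>0. \<forall>x y :: 'a.
        norm x = 1 \<and> norm y = 1 \<and> norm (x - y) \<ge> \<epsilon> \<longrightarrow> norm ((1/2) *\<^sub>R (x + y)) \<le> 1 - \<delta>)"

definition uniformly_smooth_space :: "'a::real_normed_vector itself \<Rightarrow> bool" where
  "uniformly_smooth_space _ \<longleftrightarrow>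
     (\<exists>g. uniform_limit (sphere (0::'a) 1 \<times> sphere (0::'a) 1)
            (\<lambda>t (x, y). (norm (x + t *\<^sub>R y) - norm x) / t) g (at (0::real)))"

definition duality_set :: "'a::real_normed_vector \<Rightarrow> ('a \<Rightarrow>\<^sub>L real) set" where
  "duality_set x = {f. blinfun_apply f x = (norm x)\<^sup>2 \<and> (norm x)\<^sup>2 = (norm f)\<^sup>2}"

text \<open>
  The next two definitions are meaningful on smooth, strictly convex, reflexive Banach spaces,
  where \<open>duality_set x\<close> is a singleton for every \<open>x\<close> and the resulting map is a bijection
  onto the dual.
\<close>

definition duality_map :: "'a::real_normed_vector \<Rightarrow> ('a \<Rightarrow>\<^sub>L real)" where
  "duality_map x = (THE f. f \<in> duality_set x)"

definition duality_inv :: "('a::real_normed_vector \<Rightarrow>\<^sub>L real) \<Rightarrow> 'a" where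
  "duality_inv = inv duality_map"

definition phi :: "'a::real_normed_vector \<Rightarrow> 'a \<Rightarrow> real" where
  "phi x y = (norm x)\<^sup>2 - 2 * blinfun_apply (duality_map y) x + (norm y)\<^sup>2"

text \<open>
  The minimizer is unique for closed convex nonempty \<open>D\<close> in a smooth, strictly convex,
  reflexive Banach space. In general it is not the metric projection.
\<close>

definition gen_proj :: "'a::real_normed_vector set \<Rightarrow> 'a \<Rightarrow> 'a" where
  "gen_proj D x = (THE z. z \<in> D \<and> (\<forall>y\<in>D. phi z x \<le> phi y x))"

text \<open>
  A mapping from a set \<open>C\<close> into the space is a total function of which only the
  values on \<open>C\<close> are used.
\<close>

definition fixed_points :: "'a set \<Rightarrow> ('a \<Rightarrow> 'a) \<Rightarrow> 'a set" where
  "fixed_points C T = {x \<in> C. T x = x}"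

definition weakly_converges :: "(nat \<Rightarrow> 'a::real_normed_vector) \<Rightarrow> 'a \<Rightarrow> bool" where
  "weakly_converges z p \<longleftrightarrow>
     (\<forall>f :: 'a \<Rightarrow>\<^sub>L real. (\<lambda>n. blinfun_apply f (z n)) \<longlonglongrightarrow> blinfun_apply f p)"

definition asymptotic_fixed_points ::
    "'a::real_normed_vector set \<Rightarrow> ('a \<Rightarrow> 'a) \<Rightarrow> 'a set" where
  "asymptotic_fixed_points C T =
     {p \<in> C. \<exists>z. (\<forall>n. z n \<in> C) \<and> weakly_converges z p \<and> (\<lambda>n. z n - T (z n)) \<longlonglongrightarrow> 0}"

definition type_r :: "'a::real_normed_vector set \<Rightarrow> ('a \<Rightarrow> 'a) \<Rightarrow> bool" where
  "type_r C T \<longleftrightarrow>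
     fixed_points C T \<noteq> {} \<and>
     (\<forall>x\<in>C. \<forall>p\<in>fixed_points C T. phi p (T x) \<le> phi p x)"

definition relatively_nonexpansive :: "'a::real_normed_vector set \<Rightarrow> ('a \<Rightarrow> 'a) \<Rightarrow> bool" where
  "relatively_nonexpansive C T \<longleftrightarrow>
     type_r C T \<and> fixed_points C T = asymptotic_fixed_points C T"

end

theory Submission
  imports Defs "HOL-Complex_Analysis.Great_Picard"
begin

text \<open>
  Write \<open>w\<close> for the generalized projection of the anchor \<open>u\<close> onto the fixed point set, let \<open>v\<^sub>n\<close> be
  the point whose image under the duality mapping \<open>J\<close> is \<open>\<beta>\<^sub>n J x\<^sub>n + (1 - \<beta>\<^sub>n) J (T x\<^sub>n)\<close>, and let
  \<open>y\<^sub>n\<close> be the point with \<open>J y\<^sub>n = \<alpha>\<^sub>n J u + (1 - \<alpha>\<^sub>n) J v\<^sub>n\<close>, so that \<open>x\<^bsub>n+1\<^esub>\<close> is the projection of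
  \<open>y\<^sub>n\<close> onto \<open>C\<close>. The whole argument runs on the numbers \<open>s\<^sub>n = phi w x\<^sub>n\<close>. If \<open>J q\<close> is a convex
  combination of \<open>J r\<close> and \<open>J s\<close>, then \<open>phi w q\<close> equals the same combination of \<open>phi w r\<close> and
  \<open>phi w s\<close> minus that of \<open>phi q r\<close> and \<open>phi q s\<close> (\<open>phi_combination\<close>). This identity, the three
  point identity and \<open>phi w (T x\<^sub>n) \<le> phi w x\<^sub>n\<close> give the recursion (\<open>phi_recursion\<close>)
  \<open>s\<^bsub>n+1\<^esub> \<le> (1 - \<alpha>\<^sub>n) (s\<^sub>n - gap\<^sub>n) + \<alpha>\<^sub>n drift\<^sub>n\<close>, in which
  \<open>gap\<^sub>n = \<beta>\<^sub>n phi v\<^sub>n x\<^sub>n + (1 - \<beta>\<^sub>n) phi v\<^sub>n (T x\<^sub>n)\<close> is nonnegative and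
  \<open>drift\<^sub>n = 2 \<langle>y\<^sub>n - w, J u - J w\<rangle>\<close> is bounded above.

  The two error terms are linked (\<open>drift_le_if_gap_small\<close>): for every \<open>e > 0\<close> there is \<open>\<kappa> > 0\<close> such
  that, for large \<open>n\<close>, \<open>gap\<^sub>n \<le> \<kappa>\<close> forces \<open>drift\<^sub>n \<le> e\<close>. Otherwise some subsequence has \<open>gap\<close> tending
  to \<open>0\<close> and \<open>drift > e\<close>. Along it \<open>v\<^sub>n\<close>, \<open>x\<^sub>n\<close>, \<open>T x\<^sub>n\<close> and \<open>y\<^sub>n\<close> become arbitrarily close to each
  other, so a weak cluster point \<open>p\<close> of \<open>x\<^sub>n\<close> is an asymptotic fixed point, hence a fixed point; the
  variational characterization of \<open>w\<close> yields \<open>\<langle>p - w, J u - J w\<rangle> \<le> 0\<close>, a contradiction. As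
  \<open>\<alpha>\<^sub>n\<close> tends to \<open>0\<close>, a gap larger than \<open>\<kappa>\<close> outweighs the drift term, so in both cases
  \<open>s\<^bsub>n+1\<^esub> \<le> (1 - \<alpha>\<^sub>n) s\<^sub>n + \<alpha>\<^sub>n e\<close> for large \<open>n\<close>. Divergence of the sum of the \<open>\<alpha>\<^sub>n\<close> turns this into
  \<open>s\<^sub>n < 2 e\<close> eventually, and \<open>phi w x\<^sub>n\<close> tending to \<open>0\<close> implies that \<open>x\<^sub>n\<close> tends to \<open>w\<close>.

  The geometry of the space enters through two facts. Uniform convexity makes every decreasing
  sequence of nonempty bounded closed convex sets intersect (\<open>smulian_uniformly_convex\<close>), which
  yields minimizers of \<open>(norm y)\<^sup>2 - 2 f y\<close> over closed convex sets. These minimizers are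
  generalized projections; minimizing over the whole space shows that \<open>J\<close> is onto, and minimizing
  over a closed subspace represents the restriction of any functional to that subspace by \<open>J\<close>.
  Uniform smoothness makes the derivative of the norm the unique element of the duality set, and
  makes \<open>J\<close> norm continuous. Together they give weak sequential compactness of bounded sequences
  without separation theorems or the bidual: convergence of \<open>J d\<close> along a subsequence for \<open>d\<close> in
  a countable set suffices, and the weak limit is a common point of the closed convex hulls of the
  tails of that subsequence.
\<close>

section \<open>Uniform convexity and minimization over closed convex sets\<close>

text \<open>
  The modulus of convexity of the unit sphere carries over to the squared norm on a ball: if the
  norms of \<open>a\<close> and \<open>b\<close> differ by at least \<open>\<epsilon> / 4\<close>, strict convexity of the real square already
  gives the gain; otherwise both norms are at least \<open>\<epsilon> / 4\<close> and the normalized vectors are apart.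
\<close>
lemma uniformly_convex_norm_square:
  assumes uc: "uniformly_convex_space TYPE('a::real_normed_vector)" and e: "\<epsilon> > 0"
  shows "\<exists>\<delta>>0. \<forall>a b :: 'a. norm a \<le> R \<and> norm b \<le> R \<and> norm (a - b) \<ge> \<epsilon> \<longrightarrow>
           (norm ((1/2) *\<^sub>R (a + b)))\<^sup>2 \<le> ((norm a)\<^sup>2 + (norm b)\<^sup>2) / 2 - \<delta>"
proof (cases "R > 0")
  case False
  show ?thesis
  proof (intro exI[of _ 1] conjI allI impI)
    fix a b :: 'a
    assume "norm a \<le> R \<and> norm b \<le> R \<and> norm (a - b) \<ge> \<epsilon>"
    moreover from this False have "norm a \<le> 0" "norm b \<le> 0" by linarith+
    ultimately show "(norm ((1/2) *\<^sub>R (a + b)))\<^sup>2 \<le> ((norm a)\<^sup>2 + (norm b)\<^sup>2) / 2 - 1"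
      using e by simp
  qed simp
next
  case True
  have "\<epsilon> / (2 * R) > 0" using e True by simp
  with uc have "\<exists>\<delta>>0. \<forall>x y :: 'a. norm x = 1 \<and> norm y = 1 \<and> norm (x - y) \<ge> \<epsilon> / (2 * R)
      \<longrightarrow> norm ((1/2) *\<^sub>R (x + y)) \<le> 1 - \<delta>"
    unfolding uniformly_convex_space_def by (elim allE impE)
  then obtain d where d: "d > 0"
    and dd: "\<And>x y :: 'a. norm x = 1 \<Longrightarrow> norm y = 1 \<Longrightarrow> norm (x - y) \<ge> \<epsilon> / (2 * R)
               \<Longrightarrow> norm ((1/2) *\<^sub>R (x + y)) \<le> 1 - d"
    by (elim exE conjE) simp
  define \<delta> where "\<delta> = min (\<epsilon>\<^sup>2 / 64) (d * \<epsilon>\<^sup>2 / 16)"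
  have dpos: "\<delta> > 0" using e d by (simp add: \<delta>_def)
  have wlog: "(norm ((1/2) *\<^sub>R (a + b)))\<^sup>2 \<le> ((norm a)\<^sup>2 + (norm b)\<^sup>2) / 2 - \<delta>"
    if "norm a \<le> R" "norm b \<le> norm a" and ab: "norm (a - b) \<ge> \<epsilon>" for a b :: 'a
  proof -
    define s t m where "s = norm a" and "t = norm b" and "m = norm ((1/2) *\<^sub>R (a + b))"
    have st: "0 \<le> t" "t \<le> s" "s \<le> R" using that by (auto simp: s_def t_def)
    have m0: "0 \<le> m" by (simp add: m_def)
    have sum: "\<epsilon> \<le> s + t" using ab norm_triangle_ineq4[of a b] by (simp add: s_def t_def)
    have par: "(s\<^sup>2 + t\<^sup>2) / 2 = ((s + t) / 2)\<^sup>2 + (s - t)\<^sup>2 / 4"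
      by (simp add: power2_eq_square field_simps)
    have "m\<^sup>2 \<le> (s\<^sup>2 + t\<^sup>2) / 2 - \<delta>"
    proof (cases "s - t \<ge> \<epsilon> / 4")
      case True
      have "m \<le> (s + t) / 2"
        using norm_triangle_ineq[of a b] by (simp add: m_def s_def t_def)
      then have "m\<^sup>2 \<le> ((s + t) / 2)\<^sup>2" using m0 by (rule power_mono)
      moreover have "(\<epsilon> / 4)\<^sup>2 \<le> (s - t)\<^sup>2" using True e by (intro power_mono) auto
      moreover have "\<delta> \<le> (\<epsilon> / 4)\<^sup>2 / 4" by (simp add: \<delta>_def power2_eq_square)
      ultimately show ?thesis using par by linarith
    next
      case False
      then have t: "t \<ge> \<epsilon> / 4" using sum e by linarith
      have pos: "t > 0" "s > 0" using t e st by linarith+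
      define a' b' where "a' = a /\<^sub>R s" and "b' = b /\<^sub>R t"
      have n: "norm a' = 1" "norm b' = 1" using pos by (auto simp: a'_def b'_def s_def t_def)
      have aa: "a = s *\<^sub>R a'" "b = t *\<^sub>R b'" using pos by (auto simp: a'_def b'_def)
      have "a - b = s *\<^sub>R (a' - b') + (s - t) *\<^sub>R b'" by (simp add: aa algebra_simps)
      then have "norm (a - b) \<le> s * norm (a' - b') + (s - t)"
        using norm_triangle_ineq[of "s *\<^sub>R (a' - b')" "(s - t) *\<^sub>R b'"] n st by simp
      then have "\<epsilon> / 2 \<le> s * norm (a' - b')" using ab False e by linarith
      also have "\<dots> \<le> R * norm (a' - b')" using st by (intro mult_right_mono) auto
      finally have "\<epsilon> / (2 * R) \<le> norm (a' - b')" using \<open>R > 0\<close> by (simp add: field_simps)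
      from dd[OF n this] have mid: "norm ((1/2) *\<^sub>R (a' + b')) \<le> 1 - d" .
      have d1: "d \<le> 1" using mid norm_ge_zero[of "(1/2) *\<^sub>R (a' + b')"] by linarith
      have "(1/2) *\<^sub>R (a + b) = t *\<^sub>R ((1/2) *\<^sub>R (a' + b')) + ((s - t) / 2) *\<^sub>R a'"
      proof -
        have "(s / 2) *\<^sub>R a' = (t / 2) *\<^sub>R a' + ((s - t) / 2) *\<^sub>R a'"
          by (simp add: diff_divide_distrib flip: scaleR_add_left)
        then show ?thesis by (simp add: aa scaleR_add_right)
      qed
      then have "m \<le> t * norm ((1/2) *\<^sub>R (a' + b')) + (s - t) / 2"
        using norm_triangle_ineq[of "t *\<^sub>R ((1/2) *\<^sub>R (a' + b'))" "((s - t) / 2) *\<^sub>R a'"] n st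
        by (simp add: m_def)
      also have "\<dots> \<le> t * (1 - d) + (s - t) / 2"
        using mid st by (intro add_right_mono mult_left_mono) auto
      finally have "m \<le> (s + t) / 2 - t * d" by (simp add: field_simps)
      then have "m\<^sup>2 \<le> ((s + t) / 2 - t * d)\<^sup>2" using m0 by (rule power_mono)
      also have "\<dots> = ((s + t) / 2)\<^sup>2 - t * d * (s + t - t * d)"
        by (simp add: power2_eq_square field_simps)
      also have "\<dots> \<le> ((s + t) / 2)\<^sup>2 - \<delta>"
      proof -
        have "t * d \<le> t" using d1 pos by simp
        then have "s + t - t * d \<ge> \<epsilon> / 4" using st t by linarith
        moreover have "t * d \<ge> (\<epsilon> / 4) * d" using t d by simp
        ultimately have "(\<epsilon> / 4) * d * (\<epsilon> / 4) \<le> t * d * (s + t - t * d)"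
          using e d by (intro mult_mono) auto
        moreover have "\<delta> \<le> (\<epsilon> / 4) * d * (\<epsilon> / 4)" by (simp add: \<delta>_def power2_eq_square min_def mult_ac)
        ultimately show ?thesis by linarith
      qed
      also have "\<dots> \<le> (s\<^sup>2 + t\<^sup>2) / 2 - \<delta>" using par by simp
      finally show ?thesis .
    qed
    then show ?thesis by (simp add: s_def t_def m_def)
  qed
  show ?thesis
  proof (intro exI[of _ \<delta>] conjI allI impI dpos)
    fix a b :: 'a
    assume ab: "norm a \<le> R \<and> norm b \<le> R \<and> norm (a - b) \<ge> \<epsilon>"
    show "(norm ((1/2) *\<^sub>R (a + b)))\<^sup>2 \<le> ((norm a)\<^sup>2 + (norm b)\<^sup>2) / 2 - \<delta>"
    proof (cases "norm b \<le> norm a")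
      case True
      then show ?thesis using wlog[of a b] ab by auto
    next
      case False
      then show ?thesis using wlog[of b a] ab by (auto simp: norm_minus_commute add.commute)
    qed
  qed
qed

text \<open>
  The point is the limit of almost norm-minimal elements \<open>a\<^sub>n\<close> of \<open>K\<^sub>n\<close>: the minimal squared norms
  \<open>r\<^sub>n\<close> increase to a finite limit, and the midpoint of \<open>a\<^sub>m\<close> and \<open>a\<^sub>n\<close>, for \<open>m < n\<close>, lies in \<open>K\<^sub>m\<close>,
  so the gain from uniform convexity makes \<open>a\<close> a Cauchy sequence.
\<close>
lemma smulian_uniformly_convex:
  fixes K :: "nat \<Rightarrow> 'a::banach set"
  assumes uc: "uniformly_convex_space TYPE('a)"
    and dec: "decseq K" and cl: "\<And>n. closed (K n)" and cv: "\<And>n. convex (K n)"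
    and ne: "\<And>n. K n \<noteq> {}" and bd: "bounded (K 0)"
  shows "\<exists>p. \<forall>n. p \<in> K n"
proof -
  obtain R where R: "\<And>y. y \<in> K 0 \<Longrightarrow> norm y \<le> R" using bd by (auto simp: bounded_iff)
  have sub: "K n \<subseteq> K m" if "m \<le> n" for m n using dec that by (auto simp: decseq_def)
  define r where "r n = (INF y\<in>K n. (norm y)\<^sup>2)" for n
  have bb: "bdd_below ((\<lambda>y. (norm y)\<^sup>2) ` K n)" for n by (rule bdd_belowI[of _ 0]) auto
  have rle: "r n \<le> (norm y)\<^sup>2" if "y \<in> K n" for n y
    unfolding r_def using bb that by (rule cINF_lower)
  have "\<exists>y\<in>K n. (norm y)\<^sup>2 < r n + 1 / Suc n" for n
  proof -
    have "r n < r n + 1 / Suc n" by simp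
    then show ?thesis unfolding r_def by (subst (asm) cINF_less_iff[OF ne bb]) auto
  qed
  then obtain a where a: "\<And>n. a n \<in> K n" and an: "\<And>n. (norm (a n))\<^sup>2 < r n + 1 / Suc n" by metis
  have inc: "incseq r"
    unfolding incseq_def r_def by (intro allI impI cINF_superset_mono ne bb sub) simp_all
  have rR: "r n \<le> R\<^sup>2" for n
  proof -
    have "norm (a n) \<le> R" using R a sub[of 0 n] by auto
    then have "(norm (a n))\<^sup>2 \<le> R\<^sup>2" by (intro power_mono) auto
    then show ?thesis using rle[OF a[of n]] by linarith
  qed
  obtain r' where r': "r \<longlonglongrightarrow> r'" using incseq_convergent[OF inc, of "R\<^sup>2"] rR by blast
  have rr': "r n \<le> r'" for n by (rule incseq_le[OF inc r'])
  have "Cauchy a"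
  proof (rule CauchyI')
    fix e :: real assume e: "e > 0"
    obtain d where d: "d > 0" and dd: "\<And>a b :: 'a. norm a \<le> R \<Longrightarrow> norm b \<le> R \<Longrightarrow> norm (a - b) \<ge> e \<Longrightarrow>
           (norm ((1/2) *\<^sub>R (a + b)))\<^sup>2 \<le> ((norm a)\<^sup>2 + (norm b)\<^sup>2) / 2 - d"
      using uniformly_convex_norm_square[OF uc e, of R] by (elim exE conjE) simp
    have "\<forall>\<^sub>F n in sequentially. r' - d / 2 < r n"
      using order_tendstoD(1)[OF r', of "r' - d / 2"] d by simp
    moreover have "\<forall>\<^sub>F n in sequentially. 1 / real (Suc n) < d / 2"
      using order_tendstoD(2)[OF LIMSEQ_Suc[OF lim_1_over_n], of "d / 2"] d by simp
    ultimately have "\<forall>\<^sub>F n in sequentially. r' - d / 2 < r n \<and> 1 / real (Suc n) < d / 2"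
      by (rule eventually_conj)
    then obtain M where M: "\<And>n. n \<ge> M \<Longrightarrow> r' - d / 2 < r n \<and> 1 / real (Suc n) < d / 2"
      unfolding eventually_sequentially by blast
    show "\<exists>M. \<forall>m\<ge>M. \<forall>n>m. dist (a m) (a n) < e"
    proof (intro exI[of _ M] allI impI)
      fix m n assume mn: "m \<ge> M" "m < n"
      show "dist (a m) (a n) < e"
      proof (rule ccontr)
        assume "\<not> dist (a m) (a n) < e"
        moreover have "norm (a m) \<le> R" "norm (a n) \<le> R" using R a sub[of 0] by blast+
        ultimately have 1: "(norm ((1/2) *\<^sub>R (a m + a n)))\<^sup>2 \<le> ((norm (a m))\<^sup>2 + (norm (a n))\<^sup>2) / 2 - d"
          using dd by (simp add: dist_norm)
        have "a n \<in> K m" using a sub[of m n] mn by auto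
        then have "(1/2) *\<^sub>R a m + (1/2) *\<^sub>R a n \<in> K m" using cv a by (intro convexD) auto
        then have "r m \<le> (norm ((1/2) *\<^sub>R (a m + a n)))\<^sup>2" using rle by (simp add: scaleR_add_right)
        moreover have "M \<le> n" using mn by simp
        ultimately have "(norm (a m))\<^sup>2 < r m + d / 2" "(norm (a n))\<^sup>2 < r' + d / 2"
          "r m \<le> ((norm (a m))\<^sup>2 + (norm (a n))\<^sup>2) / 2 - d" "r' - d / 2 < r m"
          using 1 an[of m] an[of n] M[of m] M[of n] rr'[of n] mn(1) by linarith+
        then show False using d by argo
      qed
    qed
  qed
  then obtain p where p: "a \<longlonglongrightarrow> p" using Cauchy_convergent_iff convergent_def by blast
  have "p \<in> K n" for n
  proof -
    have "a m \<in> K n" if "n \<le> m" for m using a[of m] sub[OF that] by blast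
    then have "\<forall>\<^sub>F m in sequentially. a m \<in> K n"
      unfolding eventually_sequentially by blast
    then show ?thesis by (rule Lim_in_closed_set[OF cl _ trivial_limit_sequentially p])
  qed
  then show ?thesis by blast
qed

text \<open>
  The sets of almost minimizers satisfy the hypotheses of the previous lemma. With
  \<open>f = duality_map x\<close> the objective is \<open>phi y x\<close> up to a constant.
\<close>
lemma ex_minimizer_norm_square_minus_functional:
  fixes D :: "'a::banach set" and f :: "'a \<Rightarrow>\<^sub>L real"
  assumes uc: "uniformly_convex_space TYPE('a)"
    and "closed D" "convex D" "D \<noteq> {}"
  shows "\<exists>z\<in>D. \<forall>y\<in>D. (norm z)\<^sup>2 - 2 * f z \<le> (norm y)\<^sup>2 - 2 * f y"
proof -
  define G where "G y = (norm y)\<^sup>2 - 2 * f y" for y :: 'a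
  have low: "(norm y - norm f)\<^sup>2 \<le> G y + (norm f)\<^sup>2" for y
  proof -
    have "f y \<le> norm y * norm f" using norm_blinfun[of f y] by (simp add: mult.commute)
    then show ?thesis unfolding G_def power2_diff by simp
  qed
  have bb: "bdd_below (G ` D)"
  proof (rule bdd_belowI2)
    fix y show "- (norm f)\<^sup>2 \<le> G y" using low[of y] zero_le_power2[of "norm y - norm f"] by linarith
  qed
  define g where "g = (INF y\<in>D. G y)"
  define K where "K n = {y \<in> D. G y \<le> g + 1 / Suc n}" for n :: nat
  have conv: "G (s *\<^sub>R x + t *\<^sub>R y) \<le> s * G x + t * G y"
    if st: "0 \<le> s" "0 \<le> t" "s + t = 1" for s t x y
  proof -
    have "norm (s *\<^sub>R x + t *\<^sub>R y) \<le> s * norm x + t * norm y"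
      using norm_triangle_ineq[of "s *\<^sub>R x" "t *\<^sub>R y"] st by simp
    then have "(norm (s *\<^sub>R x + t *\<^sub>R y))\<^sup>2 \<le> (s * norm x + t * norm y)\<^sup>2"
      by (intro power_mono) auto
    also have "\<dots> = (s + t) * (s * (norm x)\<^sup>2 + t * (norm y)\<^sup>2) - s * t * (norm x - norm y)\<^sup>2"
      by (simp add: power2_eq_square algebra_simps)
    also have "\<dots> \<le> s * (norm x)\<^sup>2 + t * (norm y)\<^sup>2" using st by simp
    finally show ?thesis by (simp add: G_def blinfun.bilinear_simps algebra_simps)
  qed
  have cont: "continuous_on UNIV G"
    unfolding G_def by (intro continuous_intros)
  have "\<exists>z. \<forall>n. z \<in> K n"
  proof (rule smulian_uniformly_convex[OF uc])
    have "K n \<subseteq> K m" if "m \<le> n" for m n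
    proof -
      have "1 / real (Suc n) \<le> 1 / real (Suc m)" using that by (simp add: frac_le)
      then show ?thesis unfolding K_def by (intro Collect_mono) linarith
    qed
    then show "decseq K" unfolding decseq_def by blast
    fix n
    have eq: "K n = D \<inter> G -` {..g + 1 / Suc n}" by (auto simp: K_def)
    show "closed (K n)" unfolding eq
      using assms(2) cont by (intro closed_Int closed_vimage) auto
    show "convex (K n)"
    proof (rule convexI)
      fix x y s t assume xy: "x \<in> K n" "y \<in> K n" and st: "0 \<le> s" "0 \<le> t" "s + t = (1::real)"
      have "G (s *\<^sub>R x + t *\<^sub>R y) \<le> s * G x + t * G y" by (rule conv[OF st])
      also have "\<dots> \<le> g + 1 / Suc n"
        using xy st by (intro convex_bound_le) (auto simp: K_def)
      finally show "s *\<^sub>R x + t *\<^sub>R y \<in> K n"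
        using xy st convexD[OF \<open>convex D\<close>] by (simp add: K_def)
    qed
    have "g < g + 1 / Suc n" by simp
    then obtain y where "y \<in> D" "G y < g + 1 / Suc n"
      unfolding g_def cINF_less_iff[OF assms(4) bb] by blast
    then have "y \<in> K n" unfolding K_def by simp
    then show "K n \<noteq> {}" by blast
  next
    show "bounded (K 0)"
    proof (rule boundedI)
      fix y assume "y \<in> K 0"
      then have "G y \<le> g + 1" by (simp add: K_def)
      then have "(norm y - norm f)\<^sup>2 \<le> g + 1 + (norm f)\<^sup>2" using low[of y] by linarith
      then have "norm y - norm f \<le> sqrt (g + 1 + (norm f)\<^sup>2)" by (rule real_le_rsqrt)
      then show "norm y \<le> norm f + sqrt (g + 1 + (norm f)\<^sup>2)" by linarith
    qed
  qed
  then obtain z where z: "\<And>n. z \<in> K n" by blast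
  have "G z \<le> g + 1 / Suc n" for n using z by (simp add: K_def)
  moreover have "(\<lambda>n. g + 1 / real (Suc n)) \<longlonglongrightarrow> g + 0"
    by (intro tendsto_add tendsto_const LIMSEQ_Suc[OF lim_1_over_n])
  ultimately have "G z \<le> g + 0" by (intro LIMSEQ_le_const[of _ "g + 0"]) blast+
  then have "G z \<le> G y" if "y \<in> D" for y
    using cINF_lower[OF bb that] unfolding g_def by linarith
  moreover have "z \<in> D" using z[of 0] unfolding K_def by simp
  ultimately show ?thesis unfolding G_def by blast
qed

section \<open>The duality mapping of a uniformly convex and uniformly smooth space\<close>

text \<open>
  The directional derivative of the norm at a unit vector is linear: it is homogeneous because
  the limit is two-sided, subadditive by the triangle inequality, and hence additive. The second
  part is the uniformity of the limit over unit directions.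
\<close>
lemma unit_norm_derivative:
  fixes x :: "'a::real_normed_vector"
  assumes us: "uniformly_smooth_space TYPE('a)" and x: "norm x = 1"
  shows "\<exists>f :: 'a \<Rightarrow>\<^sub>L real. (\<forall>y. ((\<lambda>t. (norm (x + t *\<^sub>R y) - 1) / t) \<longlongrightarrow> f y) (at 0))
           \<and> (\<forall>\<epsilon>>0. \<exists>t>0. \<forall>y. norm y = 1 \<longrightarrow> norm (x + t *\<^sub>R y) - 1 \<le> t * (f y + \<epsilon>))"
proof -
  obtain g where g: "uniform_limit (sphere (0::'a) 1 \<times> sphere (0::'a) 1)
            (\<lambda>t (x, y). (norm (x + t *\<^sub>R y) - norm x) / t) g (at (0::real))"
    using us unfolding uniformly_smooth_space_def by blast
  have unit: "((\<lambda>t. (norm (x + t *\<^sub>R y) - 1) / t) \<longlongrightarrow> g (x, y)) (at 0)"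
    if "norm y = 1" for y
    using tendsto_uniform_limitI[OF g, of "(x, y)"] x that by simp
  define q where "q y t = (norm (x + t *\<^sub>R y) - 1) / t" for y and t :: real
  have scale: "(q (c *\<^sub>R y) \<longlongrightarrow> c * l) (at 0)" if l: "(q y \<longlongrightarrow> l) (at 0)" for c l :: real and y
  proof (cases "c = 0")
    case True
    moreover have "q 0 = (\<lambda>t. 0)" by (simp add: fun_eq_iff q_def x)
    ultimately show ?thesis by simp
  next
    case False
    have "((q y \<circ> (\<lambda>t. c * t)) \<longlongrightarrow> l) (at 0)"
    proof (rule tendsto_compose_at[OF _ l])
      show "((\<lambda>t. c * t) \<longlongrightarrow> 0) (at 0)" by (rule tendsto_eq_intros | simp)+
      show "\<forall>\<^sub>F w in at 0. c * w = 0 \<longrightarrow> q y 0 = l"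
        by (rule eventually_mono[of "\<lambda>w. w \<noteq> 0"]) (use False in \<open>simp_all add: eventually_at_filter\<close>)
    qed
    then have "((\<lambda>t. c * q y (c * t)) \<longlongrightarrow> c * l) (at 0)"
      unfolding o_def by (rule tendsto_mult_left)
    moreover have "c * q y (c * t) = q (c *\<^sub>R y) t" for t
      using False by (simp add: q_def mult.commute)
    ultimately show ?thesis by simp
  qed
  have ex: "\<exists>l. (q y \<longlongrightarrow> l) (at 0)" for y
  proof (cases "y = 0")
    case True
    have "(\<lambda>t. q 0 t) = (\<lambda>t. 0)" by (simp add: q_def x)
    then show ?thesis using True tendsto_const by metis
  next
    case False
    then have "(q (y /\<^sub>R norm y) \<longlongrightarrow> g (x, y /\<^sub>R norm y)) (at 0)"
      unfolding q_def by (intro unit) auto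
    from scale[OF this, of "norm y"] show ?thesis using False by auto
  qed
  then obtain p where p: "\<And>y. (q y \<longlongrightarrow> p y) (at 0)" by metis
  have uniq: "p y = l" if "(q y \<longlongrightarrow> l) (at 0)" for y l
    using tendsto_unique[OF _ p that] by simp
  have hom: "p (c *\<^sub>R y) = c * p y" for c y by (rule uniq[OF scale[OF p]])
  have sub: "p (y + z) \<le> p y + p z" for y z
  proof -
    have r: "(q v \<longlongrightarrow> p v) (at_right 0)" for v using p by (simp add: filterlim_at_split)
    have "((\<lambda>t. q y t + q z t) \<longlongrightarrow> p y + p z) (at_right 0)" by (intro tendsto_add r)
    moreover have "(q ((1/2) *\<^sub>R (y + z)) \<longlongrightarrow> p ((1/2) *\<^sub>R (y + z))) (at_right 0)" by (rule r)
    moreover have "\<forall>\<^sub>F t in at_right 0. 2 * q ((1/2) *\<^sub>R (y + z)) t \<le> q y t + q z t"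
    proof -
      have "2 * q ((1/2) *\<^sub>R (y + z)) t \<le> q y t + q z t" if "t > 0" for t
      proof -
        define m where "m = x + t *\<^sub>R ((1/2) *\<^sub>R (y + z))"
        have "2 *\<^sub>R m = (x + t *\<^sub>R y) + (x + t *\<^sub>R z)"
          by (simp add: m_def algebra_simps scaleR_2)
        then have "norm (2 *\<^sub>R m) \<le> norm (x + t *\<^sub>R y) + norm (x + t *\<^sub>R z)"
          by (metis norm_triangle_ineq)
        then have "2 * (norm m - 1) \<le> (norm (x + t *\<^sub>R y) - 1) + (norm (x + t *\<^sub>R z) - 1)"
          by simp
        then have "2 * (norm m - 1) / t
            \<le> ((norm (x + t *\<^sub>R y) - 1) + (norm (x + t *\<^sub>R z) - 1)) / t"
          using that by (intro divide_right_mono) auto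
        then show ?thesis
          unfolding q_def m_def[symmetric] by (simp only: add_divide_distrib times_divide_eq_right)
      qed
      then show ?thesis by (simp add: eventually_at_filter)
    qed
    ultimately have "2 * p ((1/2) *\<^sub>R (y + z)) \<le> p y + p z"
      by (intro tendsto_le[OF _ _ tendsto_mult_left]) auto
    then show ?thesis by (simp add: hom)
  qed
  have add: "p (y + z) = p y + p z" for y z
  proof (rule antisym[OF sub])
    have "p ((y + z) + (-1) *\<^sub>R z) \<le> p (y + z) + p ((-1) *\<^sub>R z)" by (rule sub)
    then show "p y + p z \<le> p (y + z)" unfolding hom by simp
  qed
  have bound: "\<bar>p y\<bar> \<le> norm y" for y
  proof (rule tendsto_upperbound)
    show "((\<lambda>t. \<bar>q y t\<bar>) \<longlongrightarrow> \<bar>p y\<bar>) (at 0)" by (intro tendsto_rabs p)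
    have "\<bar>q y t\<bar> \<le> norm y" if "t \<noteq> 0" for t
    proof -
      have "\<bar>norm (x + t *\<^sub>R y) - norm x\<bar> \<le> \<bar>t\<bar> * norm y"
        using norm_triangle_ineq3[of "x + t *\<^sub>R y" x] by simp
      then show ?thesis using that by (simp add: q_def x field_simps)
    qed
    then show "\<forall>\<^sub>F t in at 0. \<bar>q y t\<bar> \<le> norm y" by (simp add: eventually_at_filter)
  qed simp
  have "bounded_linear p"
    by (rule bounded_linear_intro[of _ 1]) (auto simp: add hom bound)
  then have bl: "blinfun_apply (Blinfun p) = p" by (rule bounded_linear_Blinfun_apply)
  have "\<exists>t>0. \<forall>y. norm y = 1 \<longrightarrow> norm (x + t *\<^sub>R y) - 1 \<le> t * (p y + \<epsilon>)" if "\<epsilon> > 0" for \<epsilon>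
  proof -
    define P where "P t \<longleftrightarrow> (\<forall>v\<in>sphere 0 1 \<times> sphere (0::'a) 1.
      dist (case v of (x, y) \<Rightarrow> (norm (x + t *\<^sub>R y) - norm x) / t) (g v) < \<epsilon>)" for t
    have "\<forall>\<^sub>F t in at 0. P t"
      unfolding P_def by (rule uniform_limitD[OF g that])
    then have "\<forall>\<^sub>F t in at_right 0. P t" by (simp add: eventually_at_split)
    moreover have "\<forall>\<^sub>F t in at_right (0::real). 0 < t" by (simp add: eventually_at_filter)
    ultimately have "\<forall>\<^sub>F t in at_right 0. P t \<and> 0 < t" by (rule eventually_conj)
    from eventually_happens'[OF trivial_limit_at_right_real this]
    obtain t where t: "P t" "0 < t" by blast
    have "norm (x + t *\<^sub>R y) - 1 \<le> t * (p y + \<epsilon>)" if y: "norm y = 1" for y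
    proof -
      have "p y = g (x, y)" by (rule uniq) (use unit[OF y] in \<open>simp add: q_def[abs_def]\<close>)
      then have "dist ((norm (x + t *\<^sub>R y) - 1) / t) (p y) < \<epsilon>"
        using bspec[OF t(1)[unfolded P_def], of "(x, y)"] x y by simp
      then have "(norm (x + t *\<^sub>R y) - 1) / t \<le> p y + \<epsilon>" unfolding dist_real_def by linarith
      then show ?thesis using t(2) by (simp add: field_simps)
    qed
    then show ?thesis using t(2) by blast
  qed
  then show ?thesis using p by (intro exI[of _ "Blinfun p"]) (simp add: bl q_def[abs_def])
qed

lemma duality_set_iff:
  "f \<in> duality_set x \<longleftrightarrow> f x = (norm x)\<^sup>2 \<and> norm f = norm x"
  by (auto simp: duality_set_def power2_eq_iff_nonneg)

lemma duality_set_scaleR: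
  assumes "f \<in> duality_set x"
  shows "c *\<^sub>R f \<in> duality_set (c *\<^sub>R x)"
  using assms by (simp add: duality_set_iff blinfun.bilinear_simps power2_eq_square mult_ac)

text \<open>
  The difference quotients bound an element of the duality set from above for positive and from
  below for negative increments, so it can only be the derivative.
\<close>
lemma duality_set_unit_eq_derivative:
  assumes x: "norm x = 1" and h: "h \<in> duality_set x"
    and lim: "((\<lambda>t. (norm (x + t *\<^sub>R y) - 1) / t) \<longlongrightarrow> l) (at 0)"
  shows "h y = l"
proof -
  have up: "1 + t * h y \<le> norm (x + t *\<^sub>R y)" for t
    using norm_blinfun[of h "x + t *\<^sub>R y"] h x by (simp add: duality_set_iff blinfun.bilinear_simps)
  have "h y \<le> l"
  proof (rule tendsto_lowerbound)
    show "((\<lambda>t. (norm (x + t *\<^sub>R y) - 1) / t) \<longlongrightarrow> l) (at_right 0)"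
      using lim by (simp add: filterlim_at_split)
    have "h y \<le> (norm (x + t *\<^sub>R y) - 1) / t" if "t > 0" for t
      using up[of t] that by (simp add: field_simps)
    then show "\<forall>\<^sub>F t in at_right 0. h y \<le> (norm (x + t *\<^sub>R y) - 1) / t"
      by (simp add: eventually_at_filter)
  qed simp
  moreover have "l \<le> h y"
  proof (rule tendsto_upperbound)
    show "((\<lambda>t. (norm (x + t *\<^sub>R y) - 1) / t) \<longlongrightarrow> l) (at_left 0)"
      using lim by (simp add: filterlim_at_split)
    have "(norm (x + t *\<^sub>R y) - 1) / t \<le> h y" if "t < 0" for t
      using up[of t] that by (simp add: field_simps)
    then show "\<forall>\<^sub>F t in at_left 0. (norm (x + t *\<^sub>R y) - 1) / t \<le> h y"
      by (simp add: eventually_at_filter)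
  qed simp
  ultimately show ?thesis by simp
qed

lemma ex1_duality_set:
  assumes us: "uniformly_smooth_space TYPE('a::real_normed_vector)"
  shows "\<exists>!f. f \<in> duality_set (x :: 'a)"
proof -
  have unit: "\<exists>!f. f \<in> duality_set x" if x: "norm x = 1" for x :: 'a
  proof -
    obtain d :: "'a \<Rightarrow>\<^sub>L real" where lim: "\<And>y. ((\<lambda>t. (norm (x + t *\<^sub>R y) - 1) / t) \<longlongrightarrow> d y) (at 0)"
      using unit_norm_derivative[OF us x] by blast
    have "norm (d y) \<le> 1 * norm y" for y
    proof (rule tendsto_upperbound)
      show "((\<lambda>t. norm ((norm (x + t *\<^sub>R y) - 1) / t)) \<longlongrightarrow> norm (d y)) (at 0)"
        by (intro tendsto_norm lim)
      have "norm ((norm (x + t *\<^sub>R y) - 1) / t) \<le> 1 * norm y" if "t \<noteq> 0" for t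
      proof -
        have "\<bar>norm (x + t *\<^sub>R y) - norm x\<bar> \<le> \<bar>t\<bar> * norm y"
          using norm_triangle_ineq3[of "x + t *\<^sub>R y" x] by simp
        then show ?thesis using that by (simp add: x field_simps)
      qed
      then show "\<forall>\<^sub>F t in at 0. norm ((norm (x + t *\<^sub>R y) - 1) / t) \<le> 1 * norm y"
        by (simp add: eventually_at_filter)
    qed simp
    then have n1: "norm d \<le> 1" by (intro norm_blinfun_bound) auto
    have "((\<lambda>t::real. (norm (x + t *\<^sub>R x) - 1) / t) \<longlongrightarrow> 1) (at 0)"
    proof (rule tendsto_eventually)
      have "(norm (x + t *\<^sub>R x) - 1) / t = 1" if "\<bar>t\<bar> < 1" "t \<noteq> 0" for t
      proof -
        have "x + t *\<^sub>R x = (1 + t) *\<^sub>R x" by (simp add: algebra_simps)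
        then have "norm (x + t *\<^sub>R x) = 1 + t" using that x by simp
        then show ?thesis using that by simp
      qed
      then show "\<forall>\<^sub>F t in at 0. (norm (x + t *\<^sub>R x) - 1) / t = 1"
        unfolding eventually_at by (intro exI[of _ 1]) auto
    qed
    from tendsto_unique[OF _ lim this] have dx: "d x = 1" by simp
    then have "1 \<le> norm d" using norm_blinfun[of d x] x by simp
    then have "d \<in> duality_set x" using n1 dx x by (simp add: duality_set_iff)
    moreover have "f = d" if "f \<in> duality_set x" for f
      using duality_set_unit_eq_derivative[OF x that lim] by (rule blinfun_eqI)
    ultimately show ?thesis by blast
  qed
  show ?thesis
  proof (cases "x = 0")
    case True
    then show ?thesis by (auto simp: duality_set_iff)
  next
    case False
    define e where "e = x /\<^sub>R norm x"
    have e: "norm e = 1" "norm x *\<^sub>R e = x" using False by (auto simp: e_def)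
    obtain d where d: "d \<in> duality_set e" and uniq: "\<And>f. f \<in> duality_set e \<Longrightarrow> f = d"
      using unit[OF e(1)] by blast
    show ?thesis
    proof (rule ex1I)
      show "norm x *\<^sub>R d \<in> duality_set x"
        using duality_set_scaleR[OF d, of "norm x"] by (simp only: e)
      fix f assume "f \<in> duality_set x"
      then have "f /\<^sub>R norm x \<in> duality_set e" unfolding e_def by (rule duality_set_scaleR)
      from uniq[OF this] show "f = norm x *\<^sub>R d" using False by auto
    qed
  qed
qed

text \<open>
  The standing assumption of the following sections: the Banach space \<open>'a\<close> is uniformly convex
  and uniformly smooth.
\<close>
locale uniform_banach =
  fixes E :: "'a::banach itself"
  assumes uc: "uniformly_convex_space TYPE('a)"
    and us: "uniformly_smooth_space TYPE('a)"
begin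

abbreviation J :: "'a \<Rightarrow> 'a \<Rightarrow>\<^sub>L real" where "J \<equiv> duality_map"

lemma J_in: "J x \<in> duality_set x"
  unfolding duality_map_def by (rule theI'[OF ex1_duality_set[OF us]])

lemma J_eqI: "f \<in> duality_set x \<Longrightarrow> J x = f"
  using ex1_duality_set[OF us] J_in by blast

lemma J_self [simp]: "J x x = (norm x)\<^sup>2" and norm_J [simp]: "norm (J x) = norm x"
  using J_in[of x] by (auto simp: duality_set_iff)

lemma J_scaleR: "J (c *\<^sub>R x) = c *\<^sub>R J x"
  by (intro J_eqI duality_set_scaleR J_in)

lemma J_le: "J x y \<le> norm x * norm y"
  using norm_blinfun[of "J x" y] by simp

text \<open>\<open>2 J x\<close> is a subgradient of the squared norm at \<open>x\<close>.\<close>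
lemma norm_square_tangent: "(norm x)\<^sup>2 + 2 * J x (y - x) \<le> (norm y)\<^sup>2"
proof -
  have "0 \<le> (norm y - norm x)\<^sup>2" by simp
  then show ?thesis using J_le[of x y] unfolding power2_diff blinfun.diff_right J_self
    by (simp add: mult.commute) 
qed

text \<open>
  For unit vectors \<open>y\<close>, the tangent inequality at \<open>z\<close> bounds \<open>t J z y\<close> by \<open>norm (z + t y) - 1\<close>,
  and this is at most \<open>t (J x y + \<epsilon> / 2) + norm (z - x)\<close> for a \<open>t\<close> that does not depend on \<open>y\<close>.
\<close>
lemma J_continuous_at_unit:
  assumes x: "norm x = 1" and e: "\<epsilon> > 0"
  shows "\<exists>\<delta>>0. \<forall>z. norm z = 1 \<longrightarrow> norm (z - x) < \<delta> \<longrightarrow> norm (J z - J x) \<le> \<epsilon>"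
proof -
  obtain f :: "'a \<Rightarrow>\<^sub>L real" where
    lim: "\<And>y. ((\<lambda>t. (norm (x + t *\<^sub>R y) - 1) / t) \<longlongrightarrow> f y) (at 0)" and
    unif: "\<And>\<epsilon>. \<epsilon> > 0 \<Longrightarrow> \<exists>t>0. \<forall>y. norm y = 1 \<longrightarrow> norm (x + t *\<^sub>R y) - 1 \<le> t * (f y + \<epsilon>)"
    using unit_norm_derivative[OF us x] by blast
  have "J x = f"
    using duality_set_unit_eq_derivative[OF x J_in lim] by (rule blinfun_eqI)
  moreover have "\<epsilon> / 2 > 0" using e by simp
  ultimately obtain t where t: "t > 0"
    and ty: "\<And>y. norm y = 1 \<Longrightarrow> norm (x + t *\<^sub>R y) - 1 \<le> t * (J x y + \<epsilon> / 2)"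
    using unif by blast
  show ?thesis
  proof (intro exI[of _ "t * \<epsilon> / 2"] conjI allI impI)
    show "t * \<epsilon> / 2 > 0" using t e by simp
    fix z assume z: "norm z = 1" and zx: "norm (z - x) < t * \<epsilon> / 2"
    have le: "J z y - J x y \<le> \<epsilon>" if y: "norm y = 1" for y
    proof -
      have "1 + t * J z y = J z (z + t *\<^sub>R y)" by (simp add: blinfun.bilinear_simps z)
      also have "\<dots> \<le> norm (z + t *\<^sub>R y)" using J_le[of z "z + t *\<^sub>R y"] z by simp
      also have "\<dots> \<le> norm (x + t *\<^sub>R y) + norm (z - x)"
        using norm_triangle_ineq[of "x + t *\<^sub>R y" "z - x"] by (simp add: algebra_simps)
      also have "\<dots> \<le> 1 + t * (J x y + \<epsilon> / 2) + t * \<epsilon> / 2" using ty[OF y] zx by linarith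
      finally have "t * J z y \<le> t * (J x y + \<epsilon>)" by (simp add: algebra_simps)
      then show ?thesis using t by simp
    qed
    show "norm (J z - J x) \<le> \<epsilon>"
    proof (rule norm_blinfun_bound)
      fix y show "norm (blinfun_apply (J z - J x) y) \<le> \<epsilon> * norm y"
      proof (cases "y = 0")
        case False
        define e where "e = y /\<^sub>R norm y"
        have n: "norm e = 1" "y = norm y *\<^sub>R e" using False by (auto simp: e_def)
        have "\<bar>J z e - J x e\<bar> \<le> \<epsilon>"
          using le[of e] le[of "- e"] n by (simp add: blinfun.bilinear_simps)
        moreover have "blinfun_apply (J z - J x) y = norm y * (J z e - J x e)"
          by (subst n(2)) (simp add: blinfun.bilinear_simps right_diff_distrib)
        ultimately have "norm (blinfun_apply (J z - J x) y) \<le> norm y * \<epsilon>"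
          by (simp add: abs_mult mult_left_mono)
        then show ?thesis by (simp only: mult.commute)
      qed simp
    qed (use e in simp)
  qed
qed

lemma J_continuous: "continuous_on UNIV J"
  unfolding continuous_on_eq_continuous_within
proof
  fix x :: 'a
  show "isCont J x"
  proof (cases "x = 0")
    case True
    have "J 0 = 0" using J_scaleR[of 0 0] by simp
    moreover have "(J \<longlongrightarrow> 0) (at 0)"
    proof (rule tendsto_norm_zero_cancel)
      show "((\<lambda>y. norm (J y)) \<longlongrightarrow> 0) (at 0)"
        using tendsto_norm[OF tendsto_ident_at[of "0::'a" UNIV]] by simp
    qed
    ultimately show ?thesis using True by (simp add: isCont_def)
  next
    case False
    define u where "u y = y /\<^sub>R norm y" for y :: 'a
    have contJ: "continuous_on (sphere 0 1) J"
      unfolding continuous_on_iff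
    proof (intro ballI allI impI)
      fix x :: 'a and e :: real assume x: "x \<in> sphere 0 1" and "e > 0"
      have "norm x = 1" "e / 2 > 0" using x \<open>e > 0\<close> by simp_all
      from J_continuous_at_unit[OF this] obtain d where "d > 0"
        and d: "\<And>z. norm z = 1 \<Longrightarrow> norm (z - x) < d \<Longrightarrow> norm (J z - J x) \<le> e / 2"
        by (elim exE conjE) simp
      have "dist (J z) (J x) < e" if "z \<in> sphere 0 1" "dist z x < d" for z
        using d[of z] that \<open>e > 0\<close> unfolding dist_norm by simp
      then show "\<exists>d>0. \<forall>x'\<in>sphere 0 1. dist x' x < d \<longrightarrow> dist (J x') (J x) < e"
        using \<open>d > 0\<close> by blast
    qed
    have nu: "norm (u y) = 1" if "y \<noteq> 0" for y using that by (simp add: u_def)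
    have "continuous_on (- {0}) u" unfolding u_def by (intro continuous_intros) auto
    moreover have "u ` (- {0}) \<subseteq> sphere 0 1" by (intro image_subsetI) (simp add: nu)
    ultimately have "continuous_on (- {0}) (\<lambda>y. J (u y))"
      by (rule continuous_on_compose2[OF contJ])
    then have "continuous_on (- {0}) (\<lambda>y. norm y *\<^sub>R J (u y))"
      by (intro continuous_on_scaleR continuous_on_norm_id)
    moreover have "norm y *\<^sub>R J (u y) = J y" if "y \<in> - {0}" for y
      using that unfolding J_scaleR[symmetric] by (simp add: u_def)
    ultimately have "continuous_on (- {0}) J" by (rule continuous_on_eq)
    moreover have "open (- {0 :: 'a})" by (intro open_Compl closed_singleton)
    ultimately have "\<forall>y\<in>- {0}. isCont J y" by (simp only: continuous_on_eq_continuous_at)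
    then show ?thesis using False by simp
  qed
qed

end

section \<open>The functional phi, surjectivity of the duality mapping, and generalized projections\<close>

context uniform_banach
begin

lemma square_diff_norm_le_phi: "(norm x - norm y)\<^sup>2 \<le> phi x (y :: 'a)"
proof -
  have "J y x \<le> norm x * norm y" using J_le[of y x] by (simp only: mult.commute)
  then show ?thesis unfolding power2_diff phi_def by simp
qed

lemma phi_nonneg: "0 \<le> phi x (y :: 'a)"
  using zero_le_power2 square_diff_norm_le_phi by (rule order_trans)

lemma phi_self [simp]: "phi x (x :: 'a) = 0"
  by (simp add: phi_def)

lemma norm_le_phi: "norm y \<le> norm x + sqrt (phi x (y :: 'a))"
proof -
  have "(norm y - norm x)\<^sup>2 \<le> phi x y"
    using square_diff_norm_le_phi[of x y] by (simp only: power2_commute)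
  then have "norm y - norm x \<le> sqrt (phi x y)" by (rule real_le_rsqrt)
  then show ?thesis by simp
qed

lemma phi_three_points: "phi x y = phi x z + phi z y + 2 * (J z (x - z) - J y (x - z))"
  by (simp add: phi_def blinfun.bilinear_simps)

lemma phi_triangle_le:
  assumes "J y (x - z) \<le> J z (x - z)"
  shows "phi x z + phi z y \<le> phi x y"
  unfolding phi_three_points[of x y z] using assms by simp

lemma phi_symmetric_sum: "phi x y + phi y x = 2 * (J x - J y) (x - y)"
  by (simp add: phi_def blinfun.bilinear_simps)

text \<open>
  The terms subtracted on the right measure the strict convexity of the squared dual norm; they
  make a modulus of convexity of the dual space unnecessary.
\<close>
lemma phi_combination:
  assumes "J q = s *\<^sub>R J y + t *\<^sub>R J z" and st: "s + t = 1"
  shows "phi x q = s * phi x y + t * phi x z - s * phi q y - t * phi q z"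
proof -
  have q: "J q v = s * J y v + t * J z v" for v using assms(1) by (simp add: blinfun.bilinear_simps)
  have t: "t = 1 - s" using st by simp
  have "(norm q)\<^sup>2 = s * J y q + t * J z q" using q[of q] by simp
  then show ?thesis unfolding phi_def q t by (simp add: algebra_simps)
qed

text \<open>
  The tangent inequality at \<open>y\<close> shows that \<open>J y x\<close> is at most the squared norm of the midpoint of
  \<open>x\<close> and \<open>y\<close>, so that \<open>phi x y\<close> is at least twice the convexity gain.
\<close>
lemma norm_diff_le_if_phi_le:
  assumes e: "\<epsilon> > 0"
  shows "\<exists>\<delta>>0. \<forall>x y :: 'a. norm x \<le> R \<longrightarrow> norm y \<le> R \<longrightarrow> phi x y < \<delta> \<longrightarrow> norm (x - y) < \<epsilon>"
proof -
  obtain d where d: "d > 0" and dd: "\<And>a b :: 'a. norm a \<le> R \<Longrightarrow> norm b \<le> R \<Longrightarrow> norm (a - b) \<ge> \<epsilon> \<Longrightarrow>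
           (norm ((1/2) *\<^sub>R (a + b)))\<^sup>2 \<le> ((norm a)\<^sup>2 + (norm b)\<^sup>2) / 2 - d"
    using uniformly_convex_norm_square[OF uc e, of R] by (elim exE conjE) simp
  have "norm (x - y) < \<epsilon>" if R: "norm x \<le> R" "norm y \<le> R" and p: "phi x y < 2 * d" for x y :: 'a
  proof (rule ccontr)
    assume "\<not> norm (x - y) < \<epsilon>"
    with R have "(norm ((1/2) *\<^sub>R (x + y)))\<^sup>2 \<le> ((norm x)\<^sup>2 + (norm y)\<^sup>2) / 2 - d"
      by (intro dd) auto
    moreover have "J y x \<le> (norm ((1/2) *\<^sub>R (x + y)))\<^sup>2"
      using norm_square_tangent[of y "(1/2) *\<^sub>R (x + y)"]
      by (simp add: blinfun.bilinear_simps diff_divide_distrib)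
    ultimately show False using p unfolding phi_def by argo
  qed
  then show ?thesis using d by (intro exI[of _ "2 * d"]) auto
qed

lemma diff_tendsto_zero_if_phi_tendsto_zero:
  fixes a b :: "nat \<Rightarrow> 'a"
  assumes lim: "(\<lambda>n. phi (a n) (b n)) \<longlonglongrightarrow> 0"
    and bd: "\<And>n. norm (a n) \<le> R" "\<And>n. norm (b n) \<le> R"
  shows "(\<lambda>n. a n - b n) \<longlonglongrightarrow> 0"
proof (rule LIMSEQ_I)
  fix e :: real assume "e > 0"
  from norm_diff_le_if_phi_le[OF this, of R] obtain d where "d > 0"
    and d: "\<And>x y :: 'a. norm x \<le> R \<Longrightarrow> norm y \<le> R \<Longrightarrow> phi x y < d \<Longrightarrow> norm (x - y) < e"
    by (elim exE conjE) simp
  from order_tendstoD(2)[OF lim \<open>d > 0\<close>] obtain N where "\<And>n. n \<ge> N \<Longrightarrow> phi (a n) (b n) < d"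
    unfolding eventually_sequentially by blast
  then have "\<forall>n\<ge>N. norm (a n - b n - 0) < e" using d bd by simp
  then show "\<exists>N. \<forall>n\<ge>N. norm (a n - b n - 0) < e" ..
qed

lemma phi_eq_zero_iff [simp]: "phi x y = 0 \<longleftrightarrow> x = (y :: 'a)"
proof
  assume "phi x y = 0"
  then have "(\<lambda>n::nat. x - y) \<longlonglongrightarrow> 0"
    by (intro diff_tendsto_zero_if_phi_tendsto_zero[of _ _ "max (norm x) (norm y)"]) auto
  then show "x = y" by (simp add: LIMSEQ_const_iff)
qed simp

text \<open>
  Comparing \<open>z\<close> with \<open>z + t (y - z)\<close> and letting \<open>t\<close> decrease to \<open>0\<close>, using continuity of \<open>J\<close>
  along this segment.
\<close>
lemma minimizer_variational:
  assumes D: "convex D" and z: "z \<in> D" and y: "y \<in> D"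
    and min: "\<And>y. y \<in> D \<Longrightarrow> (norm z)\<^sup>2 - 2 * blinfun_apply f z \<le> (norm y)\<^sup>2 - 2 * f y"
  shows "f (y - z) \<le> J z (y - z)"
proof (rule tendsto_lowerbound)
  define c where "c t = z + t *\<^sub>R (y - z)" for t :: real
  have "isCont (\<lambda>t. J (c t) (y - z)) 0"
  proof -
    have "isCont c 0" unfolding c_def by (intro continuous_intros)
    moreover have "isCont J (c 0)" using J_continuous by (simp add: continuous_on_eq_continuous_at)
    ultimately have "isCont (\<lambda>t. J (c t)) 0" by (rule isCont_o2)
    then show ?thesis by (intro continuous_intros)
  qed
  then show "((\<lambda>t. J (c t) (y - z)) \<longlongrightarrow> J z (y - z)) (at_right 0)"
    unfolding isCont_def by (simp add: filterlim_at_split c_def)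
  have "f (y - z) \<le> J (c t) (y - z)" if t: "0 < t" "t < 1" for t
  proof -
    have "(1 - t) *\<^sub>R z + t *\<^sub>R y \<in> D" using convexD[OF D z y, of "1 - t" t] t by simp
    then have "c t \<in> D" by (simp add: c_def algebra_simps)
    from min[OF this] have "(norm z)\<^sup>2 + 2 * (t * f (y - z)) \<le> (norm (c t))\<^sup>2"
      unfolding c_def blinfun.add_right blinfun.scaleR_right by simp
    moreover have "z - c t = (- t) *\<^sub>R (y - z)" by (simp add: c_def)
    then have "(norm (c t))\<^sup>2 - 2 * (t * J (c t) (y - z)) \<le> (norm z)\<^sup>2"
      using norm_square_tangent[of "c t" z] by (simp only: blinfun.scaleR_right) simp
    ultimately have "t * f (y - z) \<le> t * J (c t) (y - z)" by linarith
    then show ?thesis using t by simp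
  qed
  then show "\<forall>\<^sub>F t in at_right 0. f (y - z) \<le> J (c t) (y - z)"
    by (intro eventually_at_rightI[of 0 1]) auto
qed simp

lemma ex_variational_point:
  fixes f :: "'a \<Rightarrow>\<^sub>L real"
  assumes "closed D" "convex D" "D \<noteq> {}"
  shows "\<exists>z\<in>D. \<forall>y\<in>D. f (y - z) \<le> J z (y - z)"
  using ex_minimizer_norm_square_minus_functional[OF uc assms, of f] minimizer_variational[OF assms(2)]
  by metis

text \<open>
  On a subspace the variational inequality holds in the directions \<open>y\<close> and \<open>- y\<close>, hence is an equality.
\<close>
lemma ex_J_eq_on_subspace:
  fixes f :: "'a \<Rightarrow>\<^sub>L real"
  assumes Y: "closed Y" "subspace Y"
  shows "\<exists>z\<in>Y. \<forall>y\<in>Y. f y = J z y"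
proof -
  have "Y \<noteq> {}" using subspace_0[OF Y(2)] by blast
  from ex_variational_point[OF Y(1) subspace_imp_convex[OF Y(2)] this, of f]
  obtain z where z: "z \<in> Y" and var: "\<And>y. y \<in> Y \<Longrightarrow> f (y - z) \<le> J z (y - z)" by blast
  have "f y = J z y" if y: "y \<in> Y" for y
  proof (rule antisym)
    show "f y \<le> J z y" using var[OF subspace_add[OF Y(2) y z]] by simp
    show "J z y \<le> f y" using var[OF subspace_diff[OF Y(2) z y]] by (simp add: blinfun.bilinear_simps)
  qed
  then show ?thesis using z by blast
qed

lemma surj_J: "surj J"
  unfolding surj_def
proof
  fix f :: "'a \<Rightarrow>\<^sub>L real"
  obtain z where z: "\<forall>y\<in>UNIV. f y = J z y"
    using ex_J_eq_on_subspace[OF closed_UNIV subspace_UNIV, of f] by blast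
  then have "f = J z" by (intro blinfun_eqI) simp
  then show "\<exists>z. f = J z" ..
qed

lemma J_duality_inv [simp]: "J (duality_inv f) = f"
  unfolding duality_inv_def by (rule surj_f_inv_f[OF surj_J])

context
  fixes D :: "'a set"
  assumes D: "closed D" "convex D" "D \<noteq> {}"
begin

text \<open>
  A point with the variational inequality is the only minimizer, so the definite description in
  \<open>gen_proj\<close> is meaningful.
\<close>
lemma gen_proj_minimizer: "gen_proj D x \<in> D \<and> (\<forall>y\<in>D. phi (gen_proj D x) x \<le> phi y x)"
  unfolding gen_proj_def
proof (rule theI')
  obtain z where z: "z \<in> D" and var: "\<And>y. y \<in> D \<Longrightarrow> J x (y - z) \<le> J z (y - z)"
    using ex_variational_point[OF D, of "J x"] by blast
  have pyth: "phi y z + phi z x \<le> phi y x" if "y \<in> D" for y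
    using var[OF that] by (rule phi_triangle_le)
  show "\<exists>!z. z \<in> D \<and> (\<forall>y\<in>D. phi z x \<le> phi y x)"
  proof (rule ex1I[of _ z])
    show "z \<in> D \<and> (\<forall>y\<in>D. phi z x \<le> phi y x)"
      using z pyth phi_nonneg[of _ z] by (smt (verit))
    fix y assume "y \<in> D \<and> (\<forall>w\<in>D. phi y x \<le> phi w x)"
    then have "phi y z \<le> 0" using pyth[of y] z by force
    then show "y = z" using phi_nonneg[of y z] by (metis antisym phi_eq_zero_iff)
  qed
qed

lemma gen_proj_in: "gen_proj D x \<in> D"
  using gen_proj_minimizer by blast

lemma gen_proj_variational:
  assumes "y \<in> D"
  shows "J x (y - gen_proj D x) \<le> J (gen_proj D x) (y - gen_proj D x)"
proof (rule minimizer_variational[OF D(2) gen_proj_in assms])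
  fix y assume "y \<in> D"
  then have "phi (gen_proj D x) x \<le> phi y x" using gen_proj_minimizer by blast
  then show "(norm (gen_proj D x))\<^sup>2 - 2 * J x (gen_proj D x) \<le> (norm y)\<^sup>2 - 2 * J x y"
    by (simp add: phi_def)
qed

lemma phi_gen_proj_le:
  assumes "y \<in> D"
  shows "phi y (gen_proj D x) \<le> phi y x"
  using phi_triangle_le[OF gen_proj_variational[OF assms, of x]] phi_nonneg[of "gen_proj D x" x]
  by linarith

end

text \<open>
  Convexity holds because \<open>phi p x\<close>, for \<open>p\<close> a convex combination, differs from the combination of
  the \<open>phi\<close> values by a number independent of \<open>x\<close>; evaluating at \<open>x = T p\<close> and \<open>x = p\<close> gives
  \<open>phi p (T p) \<le> phi p p = 0\<close>.
\<close>
lemma closed_convex_fixed_points: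
  fixes C :: "'a set"
  assumes C: "closed C" "convex C" and r: "type_r C T"
  shows "closed (fixed_points C T)" "convex (fixed_points C T)"
proof -
  have le: "phi p (T x) \<le> phi p x" if "p \<in> fixed_points C T" "x \<in> C" for p x
    using r that by (simp add: type_r_def)
  have fixI: "p \<in> fixed_points C T" if "p \<in> C" "phi p (T p) \<le> 0" for p
  proof -
    have "phi p (T p) = 0" using that phi_nonneg[of p "T p"] by linarith
    then show ?thesis using that by (simp add: fixed_points_def)
  qed
  show "closed (fixed_points C T)"
    unfolding closed_sequential_limits
  proof (intro allI impI, elim conjE)
    fix s l assume s: "\<forall>n. s n \<in> fixed_points C T" and l: "s \<longlonglongrightarrow> l"
    have lC: "l \<in> C" using C(1) s l unfolding closed_sequential_limits fixed_points_def by blast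
    have lim: "(\<lambda>n. phi (s n) v) \<longlonglongrightarrow> phi l v" for v
      unfolding phi_def by (intro tendsto_intros l)
    have "phi l (T l) \<le> phi l l" by (rule LIMSEQ_le[OF lim lim]) (use le s lC in blast)
    then show "l \<in> fixed_points C T" using lC by (intro fixI) auto
  qed
  show "convex (fixed_points C T)"
  proof (rule convexI)
    fix x y :: 'a and s t :: real
    assume xy: "x \<in> fixed_points C T" "y \<in> fixed_points C T" and st: "0 \<le> s" "0 \<le> t" "s + t = 1"
    define p where "p = s *\<^sub>R x + t *\<^sub>R y"
    have pC: "p \<in> C" unfolding p_def using xy st by (intro convexD[OF C(2)]) (auto simp: fixed_points_def)
    have eq: "phi p v = s * phi x v + t * phi y v + ((norm p)\<^sup>2 - s * (norm x)\<^sup>2 - t * (norm y)\<^sup>2)" for v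
    proof -
      have "s * (norm v)\<^sup>2 + t * (norm v)\<^sup>2 = (norm v)\<^sup>2"
        using st by (simp flip: distrib_right)
      then show ?thesis
        by (simp add: phi_def p_def blinfun.bilinear_simps algebra_simps)
    qed
    have "s * phi x (T p) + t * phi y (T p) \<le> s * phi x p + t * phi y p"
      using le xy pC st by (intro add_mono mult_left_mono) auto
    then have "phi p (T p) \<le> phi p p" unfolding eq by linarith
    then show "s *\<^sub>R x + t *\<^sub>R y \<in> fixed_points C T" using pC fixI by (simp flip: p_def)
  qed
qed

end

section \<open>Weak sequential compactness\<close>

text \<open>
  \<open>D\<close> consists of the rational linear combinations of the sequence, coded by lists of pairs of a
  coefficient and an index, so that addition is concatenation of lists.
\<close>
lemma ex_countable_dense_in_closed_subspace:
  fixes z :: "nat \<Rightarrow> 'a::real_normed_vector"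
  shows "\<exists>D. countable D \<and> range z \<subseteq> D \<and> subspace (closure D)"
proof -
  define comb where "comb l = sum_list (map (\<lambda>(r, i). of_rat r *\<^sub>R z i) l)" for l :: "(rat \<times> nat) list"
  define D where "D = range comb"
  have "countable D" unfolding D_def by simp
  moreover have "z i \<in> D" for i
  proof -
    have "comb [(1, i)] = z i" by (simp add: comb_def)
    then show ?thesis unfolding D_def by (metis rangeI)
  qed
  then have "range z \<subseteq> D" by blast
  moreover have "subspace (closure D)"
  proof (rule subspaceI)
    have "comb [] = 0" by (simp add: comb_def)
    then have "0 \<in> D" unfolding D_def by (metis rangeI)
    then show "0 \<in> closure D" using closure_subset by blast
    fix x assume "x \<in> closure D"
    then obtain a where a: "\<And>n. a n \<in> D" "a \<longlonglongrightarrow> x" unfolding closure_sequential by blast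
    note seqI = closure_sequential[THEN iffD2, OF exI, OF conjI]
    {
      fix y assume "y \<in> closure D"
      then obtain b where b: "\<And>n. b n \<in> D" "b \<longlonglongrightarrow> y" unfolding closure_sequential by blast
      have "comb l + comb m = comb (l @ m)" for l m by (simp add: comb_def)
      then have "u + v \<in> D" if "u \<in> D" "v \<in> D" for u v
        using that unfolding D_def by (elim rangeE) simp
      then have "\<forall>n. a n + b n \<in> D" using a(1) b(1) by blast
      moreover have "(\<lambda>n. a n + b n) \<longlonglongrightarrow> x + y" using a(2) b(2) by (rule tendsto_add)
      ultimately show "x + y \<in> closure D" by (rule seqI)
    }
    fix c :: real
    have "c \<in> closure \<rat>" by (simp add: Rats_closure_real)
    then obtain q where q: "\<And>n. q n \<in> \<rat>" "q \<longlonglongrightarrow> c" unfolding closure_sequential by blast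
    have "\<exists>p. q n = of_rat p" for n using q(1)[of n] by (auto simp: Rats_def)
    then obtain p where p: "\<And>n. q n = of_rat (p n)" by metis
    have scale: "of_rat r *\<^sub>R comb l = comb (map (\<lambda>(s, i). (r * s, i)) l)" for r l
      by (induction l) (auto simp: comb_def scaleR_add_right of_rat_mult)
    then have "of_rat r *\<^sub>R u \<in> D" if "u \<in> D" for r u
      using that unfolding D_def by (elim rangeE) simp
    then have "\<forall>n. q n *\<^sub>R a n \<in> D" using a(1) p by simp
    moreover have "(\<lambda>n. q n *\<^sub>R a n) \<longlonglongrightarrow> c *\<^sub>R x" using q(2) a(2) by (rule tendsto_scaleR)
    ultimately show "c *\<^sub>R x \<in> closure D" by (rule seqI)
  qed
  ultimately show ?thesis by blast
qed

context uniform_banach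
begin

text \<open>
  A diagonal argument makes \<open>J d\<close> converge for all \<open>d\<close> in a countable dense subset of a closed
  subspace containing the sequence. Every functional agrees there with \<open>J y\<close> for some \<open>y\<close> in the
  subspace, and \<open>J y\<close> is a norm limit of such \<open>J d\<close>.
\<close>
lemma ex_subsequence_functionals_converge:
  fixes z :: "nat \<Rightarrow> 'a"
  assumes bd: "\<And>n. norm (z n) \<le> R"
  shows "\<exists>k. strict_mono k \<and> (\<forall>f :: 'a \<Rightarrow>\<^sub>L real. convergent (\<lambda>n. f (z (k n))))"
proof -
  obtain D where D: "countable D" "range z \<subseteq> D" "subspace (closure D)"
    using ex_countable_dense_in_closed_subspace[of z] by blast
  \<comment> \<open>The diagonal argument needs a bound uniform in \<open>d\<close>, hence the normalization.\<close>
  have "norm (J d (z n) / (norm d + 1)) \<le> R" for d n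
  proof -
    have "norm (J d (z n)) \<le> norm d * norm (z n)" using norm_blinfun[of "J d" "z n"] by simp
    also have "\<dots> \<le> (norm d + 1) * R" using bd by (intro mult_mono) auto
    finally show ?thesis by (simp add: pos_divide_le_eq add_nonneg_pos mult.commute)
  qed
  then obtain k :: "nat \<Rightarrow> nat" where k: "strict_mono k"
    and conv: "\<And>d. d \<in> D \<Longrightarrow> \<exists>l. (\<lambda>n. J d (z (k n)) / (norm d + 1)) \<longlonglongrightarrow> l"
    using function_convergent_subsequence[OF D(1), of "\<lambda>n d. J d (z n) / (norm d + 1)" R] by blast
  have convD: "convergent (\<lambda>n. J d (z (k n)))" if "d \<in> D" for d
  proof -
    obtain l where "(\<lambda>n. J d (z (k n)) / (norm d + 1)) \<longlonglongrightarrow> l" using conv[OF \<open>d \<in> D\<close>] by blast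
    then have "(\<lambda>n. J d (z (k n)) / (norm d + 1) * (norm d + 1)) \<longlonglongrightarrow> l * (norm d + 1)"
      by (rule tendsto_mult_right)
    moreover have "norm d + 1 \<noteq> 0" using norm_ge_zero[of d] by linarith
    ultimately show ?thesis unfolding convergent_def by auto
  qed
  have "convergent (\<lambda>n. f (z (k n)))" for f :: "'a \<Rightarrow>\<^sub>L real"
  proof -
    obtain y where y: "y \<in> closure D" and fy: "\<And>v. v \<in> closure D \<Longrightarrow> f v = J y v"
      using ex_J_eq_on_subspace[OF closed_closure D(3), of f] by blast
    have fz: "f (z n) = J y (z n)" for n using fy D(2) closure_subset[of D] by blast
    obtain d where d: "\<And>m. d m \<in> D" "d \<longlonglongrightarrow> y" using y unfolding closure_sequential by blast
    have "isCont J y" using J_continuous by (simp add: continuous_on_eq_continuous_at)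
    then have Jd: "(\<lambda>m. J (d m)) \<longlonglongrightarrow> J y" using d(2) by (rule isCont_tendsto_compose)
    have R: "0 \<le> R" using bd[of 0] norm_ge_zero[of "z 0"] by linarith
    have "Cauchy (\<lambda>n. f (z (k n)))"
    proof (rule metric_CauchyI)
      fix e :: real assume e: "e > 0"
      have R1: "R + 1 > 0" using R by simp
      then have "e / 3 / (R + 1) > 0" using e by simp
      from LIMSEQ_D[OF Jd this] obtain m where m: "norm (J (d m) - J y) < e / 3 / (R + 1)" by blast
      have near: "\<bar>J (d m) (z n) - f (z n)\<bar> < e / 3" for n
      proof -
        have "\<bar>J (d m) (z n) - f (z n)\<bar> \<le> norm (J (d m) - J y) * norm (z n)"
          using norm_blinfun[of "J (d m) - J y" "z n"] by (simp add: fz blinfun.diff_left)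
        also have "\<dots> \<le> norm (J (d m) - J y) * (R + 1)"
          using bd[of n] by (intro mult_left_mono) auto
        also have "\<dots> < e / 3" using m unfolding pos_less_divide_eq[OF R1] .
        finally show ?thesis .
      qed
      have "Cauchy (\<lambda>n. J (d m) (z (k n)))" using convD[OF d(1)] by (simp add: Cauchy_convergent_iff)
      from metric_CauchyD[OF this, of "e / 3"] e obtain M where
        M: "\<And>i j. i \<ge> M \<Longrightarrow> j \<ge> M \<Longrightarrow> dist (J (d m) (z (k i))) (J (d m) (z (k j))) < e / 3" by auto
      have "dist (f (z (k i))) (f (z (k j))) < e" if "i \<ge> M" "j \<ge> M" for i j
        using M[OF that] near[of "k i"] near[of "k j"] unfolding dist_real_def by linarith
      then show "\<exists>M. \<forall>m\<ge>M. \<forall>n\<ge>M. dist (f (z (k m))) (f (z (k n))) < e" by blast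
    qed
    then show ?thesis by (simp add: Cauchy_convergent_iff)
  qed
  then show ?thesis using k by blast
qed

text \<open>
  The limit is a common point of the closed convex hulls \<open>K\<^sub>m\<close> of the tails: if \<open>f\<close> lies within \<open>e\<close>
  of its limit on a tail, then also on the corresponding \<open>K\<^sub>m\<close>.
\<close>
lemma weakly_convergent_subsequence:
  fixes z :: "nat \<Rightarrow> 'a"
  assumes bd: "\<And>n. norm (z n) \<le> R" and S: "closed S" "convex S" "\<And>n. z n \<in> S"
  shows "\<exists>k p. strict_mono k \<and> p \<in> S \<and> weakly_converges (\<lambda>n. z (k n)) p"
proof -
  obtain k :: "nat \<Rightarrow> nat" where k: "strict_mono k" and conv: "\<And>f :: 'a \<Rightarrow>\<^sub>L real. convergent (\<lambda>n. f (z (k n)))"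
    using ex_subsequence_functionals_converge[of z, OF bd] by blast
  define K where "K m = closure (convex hull ((\<lambda>n. z (k n)) ` {m..}))" for m
  have Ksub: "K m \<subseteq> A" if "closed A" "convex A" "\<And>n. n \<ge> m \<Longrightarrow> z (k n) \<in> A" for A m
    unfolding K_def using that by (intro closure_minimal hull_minimal) auto
  have KI: "z (k n) \<in> K m" if "n \<ge> m" for n m
  proof -
    have "z (k n) \<in> convex hull ((\<lambda>n. z (k n)) ` {m..})" using that by (intro hull_inc) auto
    then show ?thesis unfolding K_def using closure_subset by blast
  qed
  have Kcc: "closed (K m)" "convex (K m)" for m
    unfolding K_def by (auto intro: convex_closure convex_convex_hull)
  have "\<exists>p. \<forall>m. p \<in> K m"
  proof (rule smulian_uniformly_convex[OF uc _ Kcc])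
    have "K n \<subseteq> K m" if "m \<le> n" for m n
      by (rule Ksub[OF Kcc]) (use that KI in simp)
    then show "decseq K" unfolding decseq_def by blast
    show "K n \<noteq> {}" for n using KI[of n n] by blast
    have "K 0 \<subseteq> cball 0 R" by (rule Ksub) (simp_all add: bd)
    then show "bounded (K 0)" by (rule bounded_subset[OF bounded_cball])
  qed
  then obtain p where p: "\<And>m. p \<in> K m" by blast
  have "(\<lambda>n. f (z (k n))) \<longlonglongrightarrow> f p" for f :: "'a \<Rightarrow>\<^sub>L real"
  proof -
    obtain l where l: "(\<lambda>n. f (z (k n))) \<longlonglongrightarrow> l" using conv[of f] unfolding convergent_def by blast
    have "\<bar>f p - l\<bar> \<le> e" if e: "e > 0" for e
    proof -
      from LIMSEQ_D[OF l e] obtain M where M: "\<And>n. n \<ge> M \<Longrightarrow> norm (f (z (k n)) - l) < e" by blast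
      have "K M \<subseteq> f -` cball l e"
      proof (rule Ksub)
        show "closed (f -` cball l e)"
          by (intro closed_vimage closed_cball continuous_intros)
        show "convex (f -` cball l e)"
          by (intro convex_linear_vimage convex_cball) (rule bounded_linear.linear, rule blinfun.bounded_linear_right)
        show "z (k n) \<in> f -` cball l e" if "n \<ge> M" for n
          using M[OF that] by (simp add: dist_real_def abs_minus_commute)
      qed
      then have "f p \<in> cball l e" using p[of M] by blast
      then show ?thesis by (simp add: dist_real_def abs_minus_commute)
    qed
    then have "\<bar>f p - l\<bar> \<le> 0" by (rule field_le_epsilon[of _ 0, simplified])
    then show ?thesis using l by simp
  qed
  moreover have "p \<in> S" using Ksub[OF S(1,2), of 0] S(3) p by blast
  ultimately show ?thesis unfolding weakly_converges_def using k by blast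
qed

end

section \<open>The iteration\<close>

text \<open>
  The excess \<open>s n - e\<close> shrinks by the factor \<open>1 - \<alpha> n \<le> exp (- \<alpha> n)\<close> in each step, and the product
  of these factors tends to \<open>0\<close>.
\<close>
lemma eventually_less_of_contraction_towards:
  fixes s \<alpha> :: "nat \<Rightarrow> real"
  assumes \<alpha>: "\<And>n. \<alpha> n \<le> 1"
    and div: "filterlim (\<lambda>N. \<Sum>n<N. \<alpha> n) at_top sequentially"
    and e: "e > 0"
    and rec: "\<forall>\<^sub>F n in sequentially. s (Suc n) \<le> (1 - \<alpha> n) * s n + \<alpha> n * e"
  shows "\<forall>\<^sub>F n in sequentially. s n < 2 * e"
proof -
  obtain N where rec: "\<And>n. n \<ge> N \<Longrightarrow> s (Suc n) \<le> (1 - \<alpha> n) * s n + \<alpha> n * e"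
    using rec unfolding eventually_sequentially by blast
  define A where "A m = (\<Sum>n<m. \<alpha> n)" for m
  have bound: "s n - e \<le> \<bar>s N\<bar> * exp (A N - A n)" if "n \<ge> N" for n
    using that
  proof (induction n rule: dec_induct)
    case base
    show ?case using e by simp
  next
    case (step n)
    have "s (Suc n) - e \<le> (1 - \<alpha> n) * (s n - e)" using rec[OF step(1)] by (simp add: algebra_simps)
    also have "\<dots> \<le> (1 - \<alpha> n) * (\<bar>s N\<bar> * exp (A N - A n))"
      using step.IH \<alpha>[of n] by (intro mult_left_mono) auto
    also have "\<dots> \<le> exp (- \<alpha> n) * (\<bar>s N\<bar> * exp (A N - A n))"
      using exp_ge_add_one_self[of "- \<alpha> n"] by (intro mult_right_mono) auto
    also have "\<dots> = \<bar>s N\<bar> * exp (A N - A (Suc n))"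
      by (simp add: A_def exp_diff exp_add exp_minus field_simps)
    finally show ?case .
  qed
  have "filterlim (\<lambda>n. - A n) at_bot sequentially"
    using div unfolding A_def by (simp add: filterlim_uminus_at_top)
  then have "(\<lambda>n. exp (- A n)) \<longlonglongrightarrow> 0"
    by (rule filterlim_compose[OF exp_at_bot])
  then have "(\<lambda>n. \<bar>s N\<bar> * exp (A N) * exp (- A n)) \<longlonglongrightarrow> \<bar>s N\<bar> * exp (A N) * 0"
    by (rule tendsto_mult_left)
  then have "\<forall>\<^sub>F n in sequentially. \<bar>s N\<bar> * exp (A N) * exp (- A n) < e"
    using e by (intro order_tendstoD(2)) auto
  then show ?thesis using eventually_ge_at_top[of N]
  proof eventually_elim
    case (elim n)
    have "s n - e \<le> \<bar>s N\<bar> * exp (A N - A n)" using bound elim by simp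
    also have "\<dots> = \<bar>s N\<bar> * exp (A N) * exp (- A n)"
      by (simp add: exp_diff exp_minus field_simps)
    also have "\<dots> < e" using elim by simp
    finally show ?case by simp
  qed
qed

context uniform_banach
begin

lemma phi_convex_combination_le:
  assumes "J q = a *\<^sub>R J y + (1 - a) *\<^sub>R J z" and "0 \<le> a" "a \<le> 1"
  shows "phi x q \<le> a * phi x y + (1 - a) * phi x z"
proof -
  have "0 \<le> a * phi q y" "0 \<le> (1 - a) * phi q z" using assms phi_nonneg by auto
  then show ?thesis using phi_combination[OF assms(1), of x] by simp
qed

text \<open>
  Replacing \<open>J u\<close> by \<open>J w\<close> in the combination costs the duality pairing term and makes the
  anchor contribution \<open>phi w w\<close> vanish.
\<close>
lemma phi_anchored_le:
  assumes Jy: "J y = a *\<^sub>R J u + (1 - a) *\<^sub>R J v" and a: "0 \<le> a" "a \<le> 1"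
  shows "phi w y \<le> (1 - a) * phi w v + a * (2 * (J u - J w) (y - w))"
proof -
  define q where "q = duality_inv (a *\<^sub>R J w + (1 - a) *\<^sub>R J v)"
  have Jq: "J q = a *\<^sub>R J w + (1 - a) *\<^sub>R J v" by (simp add: q_def)
  have "phi w q \<le> (1 - a) * phi w v"
    using phi_convex_combination_le[OF Jq a, of w] by simp
  moreover have "J y (w - y) - J q (w - y) = - (a * (J u - J w) (y - w))"
    unfolding Jy Jq by (simp add: blinfun.bilinear_simps algebra_simps)
  ultimately show ?thesis using phi_three_points[of w q y] phi_nonneg[of y q] by simp
qed


text \<open>
  The iteration, indexed from \<open>0\<close>. The points \<open>v n\<close> and \<open>y n\<close> are described by their images under
  \<open>J\<close>, and the bounds on the limits of \<open>\<beta>\<close> are replaced by a constant \<open>b\<close>.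
\<close>
context
  fixes C :: "'a set" and T :: "'a \<Rightarrow> 'a" and \<alpha> \<beta> :: "nat \<Rightarrow> real" and u :: 'a
    and x v y :: "nat \<Rightarrow> 'a" and w :: 'a and b :: real
  assumes C: "closed C" "convex C"
    and T: "relatively_nonexpansive C T"
    and \<alpha>: "\<And>n. 0 < \<alpha> n \<and> \<alpha> n \<le> 1" and \<alpha>0: "\<alpha> \<longlonglongrightarrow> 0"
    and \<beta>: "\<And>n. 0 \<le> \<beta> n \<and> \<beta> n \<le> 1"
    and b: "b > 0" "\<forall>\<^sub>F n in sequentially. b \<le> \<beta> n \<and> \<beta> n \<le> 1 - b"
    and x0: "x 0 \<in> C"
    and Jv: "\<And>n. J (v n) = \<beta> n *\<^sub>R J (x n) + (1 - \<beta> n) *\<^sub>R J (T (x n))"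
    and Jy: "\<And>n. J (y n) = \<alpha> n *\<^sub>R J u + (1 - \<alpha> n) *\<^sub>R J (v n)"
    and xS: "\<And>n. x (Suc n) = gen_proj C (y n)"
    and w: "w = gen_proj (fixed_points C T) u"
begin

lemma C_ne: "C \<noteq> {}" using x0 by blast

lemma type_r: "type_r C T" and fixed_eq: "fixed_points C T = asymptotic_fixed_points C T"
  using T by (auto simp: relatively_nonexpansive_def)

lemma fixed_closed_convex: "closed (fixed_points C T)" "convex (fixed_points C T)" "fixed_points C T \<noteq> {}"
  using closed_convex_fixed_points[OF C type_r] type_r by (auto simp: type_r_def)

lemma w_fixed: "w \<in> fixed_points C T"
  unfolding w by (rule gen_proj_in[OF fixed_closed_convex])

lemma x_in: "x n \<in> C"
  by (cases n) (simp_all add: x0 xS gen_proj_in[OF C C_ne])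

lemma phi_T_le: "phi w (T (x n)) \<le> phi w (x n)"
  using type_r w_fixed x_in by (simp add: type_r_def)

text \<open>The decrease of \<open>phi w\<close> caused by averaging \<open>x n\<close> and \<open>T (x n)\<close>.\<close>
definition gap where "gap n = \<beta> n * phi (v n) (x n) + (1 - \<beta> n) * phi (v n) (T (x n))"

text \<open>The first order error caused by pulling towards \<open>u\<close> instead of \<open>w\<close>.\<close>
definition drift where "drift n = 2 * (J u - J w) (y n - w)"

lemma gap_nonneg: "0 \<le> gap n"
  unfolding gap_def using \<beta>[of n] phi_nonneg by simp

lemma phi_v_le: "phi w (v n) \<le> phi w (x n) - gap n"
proof -
  have "phi w (v n) = \<beta> n * phi w (x n) + (1 - \<beta> n) * phi w (T (x n)) - gap n"
    using phi_combination[OF Jv, of n w] by (simp add: gap_def)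
  moreover have "(1 - \<beta> n) * phi w (T (x n)) \<le> (1 - \<beta> n) * phi w (x n)"
    using \<beta>[of n] phi_T_le by (intro mult_left_mono) auto
  ultimately show ?thesis by (simp add: algebra_simps)
qed

lemma phi_Suc_le: "phi w (x (Suc n)) \<le> phi w (y n)"
proof -
  have "w \<in> C" using w_fixed by (simp add: fixed_points_def)
  then show ?thesis unfolding xS by (rule phi_gen_proj_le[OF C C_ne])
qed

lemma phi_recursion:
  "phi w (x (Suc n)) \<le> (1 - \<alpha> n) * (phi w (x n) - gap n) + \<alpha> n * drift n"
proof -
  have a: "0 \<le> \<alpha> n" "\<alpha> n \<le> 1" using \<alpha>[of n] by auto
  have "phi w (x (Suc n)) \<le> phi w (y n)" by (rule phi_Suc_le)
  also have "\<dots> \<le> (1 - \<alpha> n) * phi w (v n) + \<alpha> n * drift n"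
    unfolding drift_def by (rule phi_anchored_le[OF Jy a])
  also have "\<dots> \<le> (1 - \<alpha> n) * (phi w (x n) - gap n) + \<alpha> n * drift n"
    using a phi_v_le[of n] by (intro add_right_mono mult_left_mono) auto
  finally show ?thesis .
qed

lemma phi_y_le: "phi w (y n) \<le> \<alpha> n * phi w u + (1 - \<alpha> n) * phi w (x n)"
proof -
  have a: "0 \<le> \<alpha> n" "\<alpha> n \<le> 1" using \<alpha>[of n] by auto
  have "(1 - \<alpha> n) * phi w (v n) \<le> (1 - \<alpha> n) * phi w (x n)"
    using a phi_v_le[of n] gap_nonneg[of n] by (intro mult_left_mono) auto
  then show ?thesis using phi_convex_combination_le[OF Jy a, of w] by linarith
qed

text \<open>A common bound for the norms of \<open>x n\<close>, \<open>T (x n)\<close>, \<open>v n\<close> and \<open>y n\<close>.\<close>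
definition radius where "radius = norm w + sqrt (max (phi w u) (phi w (x 0)))"

lemma phi_bounded: "phi w (x n) \<le> max (phi w u) (phi w (x 0))"
proof (induction n)
  case (Suc n)
  have "phi w (x (Suc n)) \<le> \<alpha> n * phi w u + (1 - \<alpha> n) * phi w (x n)"
    using phi_Suc_le phi_y_le by (rule order_trans)
  also have "\<dots> \<le> max (phi w u) (phi w (x 0))"
    using Suc \<alpha>[of n] by (intro convex_bound_le) auto
  finally show ?case .
qed simp

lemma norm_le_radius:
  "norm (x n) \<le> radius" "norm (T (x n)) \<le> radius" "norm (v n) \<le> radius" "norm (y n) \<le> radius"
proof -
  have n: "norm z \<le> radius" if "phi w z \<le> max (phi w u) (phi w (x 0))" for z
    using norm_le_phi[of z w] real_sqrt_le_mono[OF that] unfolding radius_def by linarith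
  show "norm (x n) \<le> radius" by (rule n[OF phi_bounded])
  show "norm (T (x n)) \<le> radius" by (rule n[OF order_trans[OF phi_T_le phi_bounded]])
  have "phi w (v n) \<le> phi w (x n)" using phi_v_le[of n] gap_nonneg[of n] by linarith
  then show "norm (v n) \<le> radius" by (intro n order_trans[OF _ phi_bounded])
  have "\<alpha> n * phi w u + (1 - \<alpha> n) * phi w (x n) \<le> max (phi w u) (phi w (x 0))"
    using phi_bounded \<alpha>[of n] by (intro convex_bound_le) auto
  then show "norm (y n) \<le> radius" by (intro n order_trans[OF phi_y_le])
qed

lemma diff_y_v_tendsto: "(\<lambda>n. y n - v n) \<longlonglongrightarrow> 0"
proof (rule diff_tendsto_zero_if_phi_tendsto_zero)
  show "norm (y n) \<le> radius" "norm (v n) \<le> radius" for n by (rule norm_le_radius)+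
  define M where "M = 2 * ((norm u + radius) * (radius + radius))"
  have "norm (phi (y n) (v n)) \<le> \<alpha> n * M" for n
  proof -
    have "phi (y n) (v n) \<le> 2 * (J (y n) - J (v n)) (y n - v n)"
      using phi_symmetric_sum[of "y n" "v n"] phi_nonneg[of "v n" "y n"] by linarith
    also have "J (y n) - J (v n) = \<alpha> n *\<^sub>R (J u - J (v n))"
      unfolding Jy by (simp add: algebra_simps)
    also have "2 * (\<alpha> n *\<^sub>R (J u - J (v n))) (y n - v n) = \<alpha> n * (2 * (J u - J (v n)) (y n - v n))"
      by (simp add: blinfun.scaleR_left)
    also have "\<dots> \<le> \<alpha> n * M"
    proof -
      have "(J u - J (v n)) (y n - v n) \<le> norm (J u - J (v n)) * norm (y n - v n)"
        using norm_blinfun[of "J u - J (v n)" "y n - v n"] by simp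
      also have "\<dots> \<le> (norm u + radius) * (radius + radius)"
      proof (intro mult_mono)
        show "norm (J u - J (v n)) \<le> norm u + radius"
          using norm_triangle_ineq4[of "J u" "J (v n)"] norm_le_radius(3)[of n] by simp
        show "norm (y n - v n) \<le> radius + radius"
          using norm_triangle_ineq4[of "y n" "v n"] norm_le_radius(3,4)[of n] by linarith
        show "0 \<le> norm u + radius"
          using norm_le_radius(3)[of n] norm_ge_zero[of "v n"] norm_ge_zero[of u] by linarith
      qed simp
      finally show ?thesis using \<alpha>[of n] unfolding M_def by (intro mult_left_mono) auto
    qed
    finally show ?thesis using phi_nonneg[of "y n" "v n"] by simp
  qed
  moreover have "(\<lambda>n. \<alpha> n * M) \<longlonglongrightarrow> 0" using tendsto_mult_right[OF \<alpha>0, of M] by simp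
  ultimately show "(\<lambda>n. phi (y n) (v n)) \<longlonglongrightarrow> 0"
    by (rule Lim_null_comparison[OF always_eventually[OF allI]])
qed

text \<open>
  The only place where weak compactness and the hypothesis on asymptotic fixed points are used.
\<close>
lemma drift_le_if_gap_small:
  assumes e: "e > 0"
  shows "\<exists>\<kappa>>0. \<forall>\<^sub>F n in sequentially. gap n \<le> \<kappa> \<longrightarrow> drift n \<le> e"
proof (rule ccontr)
  assume no: "\<not> ?thesis"
  obtain N where N: "\<And>n. n \<ge> N \<Longrightarrow> b \<le> \<beta> n \<and> \<beta> n \<le> 1 - b"
    using b(2) unfolding eventually_sequentially by blast
  have "\<exists>n\<ge>N + j. gap n \<le> 1 / real (Suc j) \<and> drift n > e" for j
  proof -
    have "\<not> (\<forall>\<^sub>F n in sequentially. gap n \<le> 1 / real (Suc j) \<longrightarrow> drift n \<le> e)"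
      using no by simp
    then show ?thesis unfolding eventually_sequentially by (meson not_less)
  qed
  \<comment> \<open>\<open>k\<close> tends to infinity, but need not be monotone.\<close>
  then obtain k where kN: "\<And>j. k j \<ge> N + j" and kgap: "\<And>j. gap (k j) \<le> 1 / real (Suc j)"
    and kdrift: "\<And>j. drift (k j) > e"
    by metis
  have k: "filterlim k at_top sequentially"
  proof (rule filterlim_at_top_mono[OF filterlim_ident])
    show "\<forall>\<^sub>F j in sequentially. j \<le> k j"
    proof (rule always_eventually, rule allI)
      fix j show "j \<le> k j" using kN[of j] by linarith
    qed
  qed
  have small: "phi (v (k j)) (x (k j)) \<le> 1 / real (Suc j) / b"
    "phi (v (k j)) (T (x (k j))) \<le> 1 / real (Suc j) / b" for j
  proof -
    have bb: "b \<le> \<beta> (k j)" "b \<le> 1 - \<beta> (k j)" using N[of "k j"] kN[of j] by auto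
    have "b * phi (v (k j)) (x (k j)) \<le> \<beta> (k j) * phi (v (k j)) (x (k j))"
      "b * phi (v (k j)) (T (x (k j))) \<le> (1 - \<beta> (k j)) * phi (v (k j)) (T (x (k j)))"
      using bb phi_nonneg by (auto intro: mult_right_mono)
    moreover have "0 \<le> \<beta> (k j) * phi (v (k j)) (x (k j))"
      "0 \<le> (1 - \<beta> (k j)) * phi (v (k j)) (T (x (k j)))"
      using \<beta>[of "k j"] phi_nonneg by auto
    ultimately have "b * phi (v (k j)) (x (k j)) \<le> 1 / real (Suc j)"
      "b * phi (v (k j)) (T (x (k j))) \<le> 1 / real (Suc j)"
      using kgap[of j] unfolding gap_def by linarith+
    then show "phi (v (k j)) (x (k j)) \<le> 1 / real (Suc j) / b"
      "phi (v (k j)) (T (x (k j))) \<le> 1 / real (Suc j) / b"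
      unfolding pos_le_divide_eq[OF b(1)] by (simp_all only: mult.commute)
  qed
  have null: "(\<lambda>j. 1 / real (Suc j) / b) \<longlonglongrightarrow> 0"
    using tendsto_divide[OF LIMSEQ_Suc[OF lim_1_over_n] tendsto_const[of b]] b(1) by simp
  have vx: "(\<lambda>j. v (k j) - x (k j)) \<longlonglongrightarrow> 0"
  proof (rule diff_tendsto_zero_if_phi_tendsto_zero[OF _ norm_le_radius(3,1)])
    show "(\<lambda>j. phi (v (k j)) (x (k j))) \<longlonglongrightarrow> 0"
      by (rule tendsto_sandwich[OF _ _ tendsto_const null]) (simp_all only: phi_nonneg small eventually_True)
  qed
  have vT: "(\<lambda>j. v (k j) - T (x (k j))) \<longlonglongrightarrow> 0"
  proof (rule diff_tendsto_zero_if_phi_tendsto_zero[OF _ norm_le_radius(3,2)])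
    show "(\<lambda>j. phi (v (k j)) (T (x (k j)))) \<longlonglongrightarrow> 0"
      by (rule tendsto_sandwich[OF _ _ tendsto_const null]) (simp_all only: phi_nonneg small eventually_True)
  qed
  have xT: "(\<lambda>j. x (k j) - T (x (k j))) \<longlonglongrightarrow> 0"
    using tendsto_diff[OF vT vx] by simp
  have yx: "(\<lambda>j. y (k j) - x (k j)) \<longlonglongrightarrow> 0"
    using tendsto_add[OF filterlim_compose[OF diff_y_v_tendsto k] vx] by simp
  obtain r p where r: "strict_mono r" and pC: "p \<in> C" and weak: "weakly_converges (\<lambda>j. x (k (r j))) p"
    using weakly_convergent_subsequence[of "\<lambda>j. x (k j)", OF norm_le_radius(1) C x_in] by blast
  have "(\<lambda>j. x (k (r j)) - T (x (k (r j)))) \<longlonglongrightarrow> 0"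
    using LIMSEQ_subseq_LIMSEQ[OF xT r] by (simp add: o_def)
  then have "p \<in> fixed_points C T"
    unfolding fixed_eq asymptotic_fixed_points_def
    using pC weak x_in by (intro CollectI conjI exI[of _ "\<lambda>j. x (k (r j))"]) auto
  then have "(J u - J w) (p - w) \<le> 0"
    using gen_proj_variational[OF fixed_closed_convex, of p u] unfolding w blinfun.diff_left by simp
  moreover have "(\<lambda>j. drift (k (r j))) \<longlonglongrightarrow> 2 * (J u - J w) (p - w)"
  proof -
    have "(\<lambda>j. (J u - J w) (y (k (r j)) - x (k (r j)))) \<longlonglongrightarrow> (J u - J w) 0"
      using LIMSEQ_subseq_LIMSEQ[OF yx r] by (intro tendsto_intros) (simp add: o_def)
    moreover have "(\<lambda>j. (J u - J w) (x (k (r j)))) \<longlonglongrightarrow> (J u - J w) p"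
      using weak unfolding weakly_converges_def by blast
    ultimately have "(\<lambda>j. (J u - J w) (y (k (r j)) - x (k (r j))) + (J u - J w) (x (k (r j))))
        \<longlonglongrightarrow> (J u - J w) 0 + (J u - J w) p" by (rule tendsto_add)
    then have "(\<lambda>j. (J u - J w) (y (k (r j)))) \<longlonglongrightarrow> (J u - J w) p"
      by (simp add: blinfun.bilinear_simps)
    then have "(\<lambda>j. 2 * ((J u - J w) (y (k (r j))) - (J u - J w) w)) \<longlonglongrightarrow> 2 * ((J u - J w) p - (J u - J w) w)"
      by (intro tendsto_mult_left tendsto_diff[OF _ tendsto_const])
    then show ?thesis by (simp only: drift_def blinfun.diff_right)
  qed
  then have "e \<le> 2 * (J u - J w) (p - w)"
    by (rule LIMSEQ_le_const) (use kdrift less_imp_le in blast)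
  ultimately show False using e by linarith
qed

lemma drift_le: "drift n \<le> 2 * (norm (J u - J w) * (radius + norm w))"
proof -
  have "(J u - J w) (y n - w) \<le> norm (J u - J w) * norm (y n - w)"
    using norm_blinfun[of "J u - J w" "y n - w"] by simp
  also have "\<dots> \<le> norm (J u - J w) * (radius + norm w)"
    using norm_triangle_ineq4[of "y n" w] norm_le_radius(4)[of n] by (intro mult_left_mono) auto
  finally show ?thesis unfolding drift_def by linarith
qed

text \<open>
  If \<open>gap n\<close> exceeds \<open>\<kappa>\<close>, its share in the recursion is at least \<open>\<kappa> / 2\<close>, while \<open>\<alpha> n * drift n\<close> is
  eventually smaller; no monotonicity of \<open>phi w (x n)\<close> is needed.
\<close>
lemma eventually_contraction:
  assumes e: "e > 0"
  shows "\<forall>\<^sub>F n in sequentially. phi w (x (Suc n)) \<le> (1 - \<alpha> n) * phi w (x n) + \<alpha> n * e"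
proof -
  obtain \<kappa> where \<kappa>: "\<kappa> > 0" and dr: "\<forall>\<^sub>F n in sequentially. gap n \<le> \<kappa> \<longrightarrow> drift n \<le> e"
    using drift_le_if_gap_small[OF e] by blast
  define M where "M = 2 * (norm (J u - J w) * (radius + norm w))"
  have "(\<lambda>n. \<alpha> n * M) \<longlonglongrightarrow> 0" using tendsto_mult_right[OF \<alpha>0, of M] by simp
  then have aM: "\<forall>\<^sub>F n in sequentially. \<alpha> n * M < \<kappa> / 2" using \<kappa> by (intro order_tendstoD(2)) auto
  have ah: "\<forall>\<^sub>F n in sequentially. \<alpha> n < 1 / 2" using \<alpha>0 by (rule order_tendstoD(2)) simp
  show ?thesis
    using dr aM ah
  proof eventually_elim
    case (elim n)
    have rec: "phi w (x (Suc n)) \<le> (1 - \<alpha> n) * phi w (x n) - (1 - \<alpha> n) * gap n + \<alpha> n * drift n"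
      using phi_recursion[of n] by (simp add: right_diff_distrib)
    show ?case
    proof (cases "gap n \<le> \<kappa>")
      case True
      then have "\<alpha> n * drift n \<le> \<alpha> n * e" using elim \<alpha>[of n] by (intro mult_left_mono) auto
      moreover have "0 \<le> (1 - \<alpha> n) * gap n" using \<alpha>[of n] gap_nonneg by auto
      ultimately show ?thesis using rec by linarith
    next
      case False
      have "1 / 2 * \<kappa> \<le> (1 - \<alpha> n) * gap n" using False elim \<kappa> by (intro mult_mono) auto
      moreover have "\<alpha> n * drift n \<le> \<alpha> n * M"
        unfolding M_def using drift_le \<alpha>[of n] by (intro mult_left_mono) auto
      moreover have "0 \<le> \<alpha> n * e" using \<alpha>[of n] e by auto
      ultimately show ?thesis using rec elim by linarith
    qed
  qed
qed


lemma halpern_mann_strong_convergence: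
  assumes div: "filterlim (\<lambda>N. \<Sum>n<N. \<alpha> n) at_top sequentially"
  shows "x \<longlonglongrightarrow> w"
proof -
  have "(\<lambda>n. phi w (x n)) \<longlonglongrightarrow> 0"
  proof (rule order_tendstoI)
    fix a :: real assume "a < 0"
    then show "\<forall>\<^sub>F n in sequentially. a < phi w (x n)"
      by (intro always_eventually allI less_le_trans[OF _ phi_nonneg])
  next
    fix a :: real assume "0 < a"
    then have "\<forall>\<^sub>F n in sequentially. phi w (x n) < 2 * (a / 2)"
      using \<alpha> by (intro eventually_less_of_contraction_towards[OF _ div] eventually_contraction) auto
    then show "\<forall>\<^sub>F n in sequentially. phi w (x n) < a" by simp
  qed
  moreover have "norm w \<le> max (norm w) radius" "norm (x n) \<le> max (norm w) radius" for n
    using norm_le_radius(1)[of n] by auto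
  ultimately have "(\<lambda>n. w - x n) \<longlonglongrightarrow> 0"
    by (rule diff_tendsto_zero_if_phi_tendsto_zero)
  from tendsto_diff[OF tendsto_const[of w] this] show ?thesis by simp
qed

end
end

theorem theorem5p5:
  fixes C :: "'a::banach set"
    and T :: "'a \<Rightarrow> 'a"
    and \<alpha> \<beta> :: "nat \<Rightarrow> real"
    and u :: 'a
    and x :: "nat \<Rightarrow> 'a"
  assumes "uniformly_convex_space TYPE('a)"
    and "uniformly_smooth_space TYPE('a)"
    and "C \<noteq> {}" and "closed C" and "convex C"
    and "relatively_nonexpansive C T"
    and "\<And>n. n \<ge> 1 \<Longrightarrow> 0 < \<alpha> n \<and> \<alpha> n \<le> 1"
    and "\<And>n. n \<ge> 1 \<Longrightarrow> 0 \<le> \<beta> n \<and> \<beta> n \<le> 1"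
    and "\<alpha> \<longlonglongrightarrow> 0"
    and "filterlim (\<lambda>N. \<Sum>n=1..N. \<alpha> n) at_top sequentially"
    and "0 < liminf (\<lambda>n. ereal (\<beta> n))"
    and "liminf (\<lambda>n. ereal (\<beta> n)) \<le> limsup (\<lambda>n. ereal (\<beta> n))"
    and "limsup (\<lambda>n. ereal (\<beta> n)) < 1"
    and "x 1 \<in> C"
    and "\<And>n. n \<ge> 1 \<Longrightarrow>
           x (n + 1) = gen_proj C (duality_inv
             (\<alpha> n *\<^sub>R duality_map u
              + (1 - \<alpha> n) *\<^sub>R (\<beta> n *\<^sub>R duality_map (x n)
                               + (1 - \<beta> n) *\<^sub>R duality_map (T (x n)))))"
  shows "x \<longlonglongrightarrow> gen_proj (fixed_points C T) u"
proof -
  interpret uniform_banach "TYPE('a)" by unfold_locales (rule assms(1), rule assms(2))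
  define v where "v n = duality_inv (\<beta> n *\<^sub>R duality_map (x n) + (1 - \<beta> n) *\<^sub>R duality_map (T (x n)))" for n
  define y where "y n = duality_inv (\<alpha> n *\<^sub>R duality_map u + (1 - \<alpha> n) *\<^sub>R duality_map (v n))" for n
  obtain b1 where b1: "0 < ereal b1" "ereal b1 < liminf (\<lambda>n. ereal (\<beta> n))"
    using ereal_dense2[OF assms(11)] by blast
  obtain b2 where b2: "limsup (\<lambda>n. ereal (\<beta> n)) < ereal b2" "ereal b2 < 1"
    using ereal_dense2[OF assms(13)] by blast
  define b where "b = min b1 (1 - b2)"
  have "b > 0" using b1 b2 by (simp add: b_def one_ereal_def zero_ereal_def)
  have "\<forall>\<^sub>F n in sequentially. b \<le> \<beta> n \<and> \<beta> n \<le> 1 - b"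
    using less_LiminfD[OF b1(2)] Limsup_lessD[OF b2(1)]
    by eventually_elim (auto simp: b_def)
  then have evb: "\<forall>\<^sub>F n in sequentially. b \<le> \<beta> (Suc n) \<and> \<beta> (Suc n) \<le> 1 - b"
    by (simp only: eventually_sequentially_Suc[of "\<lambda>n. b \<le> \<beta> n \<and> \<beta> n \<le> 1 - b"])
  \<comment> \<open>The iteration starts at index \<open>1\<close>, so all sequences are shifted by one.\<close>
  have "(\<lambda>n. x (Suc n)) \<longlonglongrightarrow> gen_proj (fixed_points C T) u"
  proof (rule halpern_mann_strong_convergence[where \<alpha> = "\<lambda>n. \<alpha> (Suc n)" and \<beta> = "\<lambda>n. \<beta> (Suc n)"
        and C = C and T = T and u = u and v = "\<lambda>n. v (Suc n)" and y = "\<lambda>n. y (Suc n)" and b = b])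
    show "filterlim (\<lambda>N. \<Sum>n<N. \<alpha> (Suc n)) at_top sequentially"
      using assms(10) by (simp add: sum.atLeast1_atMost_eq)
    show "(\<lambda>n. \<alpha> (Suc n)) \<longlonglongrightarrow> 0" using assms(9) by (rule LIMSEQ_Suc)
    show "x (Suc (Suc n)) = gen_proj C (y (Suc n))" for n
      using assms(15)[of "Suc n"] by (simp add: y_def v_def)
  qed (use assms evb \<open>b > 0\<close> in \<open>simp_all add: y_def v_def\<close>)
  then show ?thesis by (rule LIMSEQ_imp_Suc)
qed

end
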